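(* Let $n>k\ge 1$ be integers and let $T\in\mathscr{T}_{n,k}$ have vertex degree sequence $(d_i:i\in[n])$. Then for every $x=(x_1,\dots,x_n)\in(\mathbb{R}\setminus\{0\})^n$, $$|\tilde{H}_{k-1}(T)|^2\le\frac{\prod_{i\in[n]}(x_i^2)^{m_1-d_i}}{\left(\sum_{i\in[n]}x_i^2\right)^{m_1}}\prod_{\tau\in T}\sum_{i\in\tau}x_i^2 .$$ Consequently $|\tilde{H}_{k-1}(T)|^2$ is at most the infimum of the right-hand side over all such $x$. The paper states this infimum over $x\in\mathbb{R}^n\setminus\{\mathbf 0\}$, where points having some, but not all, coordinates equal to $0$ are understood as limits of points with all coordinates nonzero.
   Context: Let $n>k\ge1$ be integers and $[n]=\{1,\dots,n\}$. For $j\ge0$, $\binom{[n]}{j}$ denotes the set of $j$-element subsets of $[n]$. A $k$-dimensional simplicial complex $T$ on vertex set $[n]$ is called $\mathbb{Q}$-acyclic if all three of the following hold: - it contains every subset of $[n]$ of size at most $k$ as a face (a full $(k-1)$-skeleton); - it has exactly $\binom{n-1}{k}$ faces of dimension $k$; - its $k$th homology group $H_k(T)$ is zero. $\mathscr{T}_{n,k}$ denotes the set of such complexes. Each $T\in\mathscr{T}_{n,k}$ is identified with its set of $k$-dimensional faces, which is a subset of $\binom{[n]}{k+1}$ of size $\binom{n-1}{k}$. Accordingly, $\prod_{\tau\in T}$ ranges over these $k$-faces. $\tilde H_{k-1}(T)$ denotes the reduced $(k-1)$st homology group of $T$ with integer coefficients. For $T\in\mathscr{T}_{n,k}$ it is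 a finite abelian group, and $|\tilde H_{k-1}(T)|$ denotes its order. The degree $d_i=d_i(T)$ of a vertex $i\in[n]$ is the number of $k$-dimensional faces of $T$ containing $i$. Set $m_1=\binom{n-2}{k-1}$, $m_2=\binom{n-2}{k}$ and $m_3=\binom{n-1}{k}$. *)

theory Defs
  imports Complex_Main
begin

text \<open>Simplicial chains on vertex set [n] = {1..n}. A face is a finite set of vertices;
  a face with s vertices has dimension s-1. The empty face (dimension -1) is included,
  so that the boundary of a vertex is the empty face; this gives the augmented
  (reduced) chain complex, whence reduced homology.\<close>

definition faces_of_size :: "nat \<Rightarrow> nat \<Rightarrow> nat set set" where
  "faces_of_size n s = {A. A \<subseteq> {1..n} \<and> card A = s}"

definition chains_on :: "nat set set \<Rightarrow> (nat set \<Rightarrow> int) set" where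
  "chains_on F = {c. \<forall>A. c A \<noteq> 0 \<longrightarrow> A \<in> F}"

text \<open>Orientation sign of the face B within the face insert v B (vertices ordered
  increasingly): (-1)^(position of v).\<close>
definition bd_sign :: "nat \<Rightarrow> nat set \<Rightarrow> int" where
  "bd_sign v B = (-1) ^ card {u \<in> B. u < v}"

text \<open>Simplicial boundary map on chains over vertex set [n]:
  the boundary of [v_0<...<v_j] is sum_i (-1)^i [v_0..v_i-hat..v_j].\<close>
definition bd :: "nat \<Rightarrow> (nat set \<Rightarrow> int) \<Rightarrow> (nat set \<Rightarrow> int)" where
  "bd n c = (\<lambda>B. if B \<subseteq> {1..n}
                  then (\<Sum>v \<in> {1..n} - B. bd_sign v B * c (insert v B))
                  else 0)"

text \<open>A k-dimensional complex with full (k-1)-skeleton on [n], given by its set T of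
  k-faces (sets of size k+1). Its (k-1)-cycles, k-1 boundaries.\<close>
definition cycles_km1 :: "nat \<Rightarrow> nat \<Rightarrow> (nat set \<Rightarrow> int) set" where
  "cycles_km1 n k = {c \<in> chains_on (faces_of_size n k). bd n c = (\<lambda>_. 0)}"

definition boundaries_km1 :: "nat \<Rightarrow> nat set set \<Rightarrow> (nat set \<Rightarrow> int) set" where
  "boundaries_km1 n T = bd n ` chains_on T"

text \<open>Order of the reduced homology group H~_{k-1}(T;Z) = Z_{k-1} / B_{k-1},
  as the number of cosets (0 if infinite, as for card).\<close>
definition homology_order :: "nat \<Rightarrow> nat \<Rightarrow> nat set set \<Rightarrow> nat" where
  "homology_order n k T =
     card (cycles_km1 n k // {(a, b). a \<in> cycles_km1 n k \<and> b \<in> cycles_km1 n k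
                                   \<and> a - b \<in> boundaries_km1 n T})"

text \<open>H_k(T;Z) = 0: there are no (k+1)-faces, so H_k(T) is the kernel of the
  boundary map on k-chains supported on T.\<close>
definition Hk_zero :: "nat \<Rightarrow> nat set set \<Rightarrow> bool" where
  "Hk_zero n T = (\<forall>c \<in> chains_on T. bd n c = (\<lambda>_. 0) \<longrightarrow> c = (\<lambda>_. 0))"

definition Q_acyclic :: "nat \<Rightarrow> nat \<Rightarrow> nat set set \<Rightarrow> bool" where
  "Q_acyclic n k T =
     (T \<subseteq> faces_of_size n (k + 1) \<and> card T = (n - 1) choose k \<and> Hk_zero n T)"

definition vdeg :: "nat set set \<Rightarrow> nat \<Rightarrow> nat" where
  "vdeg T i = card {\<tau> \<in> T. i \<in> \<tau>}"

definition bound_rhs :: "nat \<Rightarrow> nat \<Rightarrow> nat set set \<Rightarrow> (nat \<Rightarrow> real) \<Rightarrow> real" where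
  "bound_rhs n k T x =
     (\<Prod>i\<in>{1..n}. (x i ^ 2) powi (int ((n - 2) choose (k - 1)) - int (vdeg T i)))
     / (\<Sum>i\<in>{1..n}. x i ^ 2) ^ ((n - 2) choose (k - 1))
     * (\<Prod>\<tau>\<in>T. \<Sum>i\<in>\<tau>. x i ^ 2)"

end

theory Submission
  imports Defs "Jordan_Normal_Form.Schur_Decomposition"
begin

text \<open>Weight the boundary matrix so that the entry at \<open>\<tau> - {v}\<close>, \<open>\<tau>\<close> is \<open>\<plusminus> x\<^sub>v\<close>; the weighted boundary is
  then contraction with the vector \<open>x\<close> in the exterior algebra. Its columns \<open>\<tau> \<in> T\<close> have squared norm
  \<open>\<Sum>i\<in>\<tau>. x\<^sub>i\<^sup>2\<close>, so by Hadamard's inequality the Gram determinant is at most the product over \<open>T\<close>.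
  The columns are cycles, hence determined by the square submatrix \<open>W\<close> of the rows avoiding vertex 1.
  With \<open>Q\<close> the contraction on the remaining vertices, the Gram matrix is
  \<open>W\<^sup>T (1 + Q\<^sup>T Q / x\<^sub>1\<^sup>2) W\<close>. The Koszul identity makes \<open>Q\<^sup>T Q\<close> a multiple of a projection whose
  rank is read off from its trace, so the middle determinant is \<open>((\<Sum>i. x\<^sub>i\<^sup>2) / x\<^sub>1\<^sup>2) ^ m\<^sub>1\<close>. Finally \<open>det W\<close>
  is, up to monomial factors in \<open>x\<close>, the determinant of an integer matrix whose columns span a lattice
  with quotient isomorphic to the reduced homology.\<close>

subsection \<open>Determinants and eigenvalues\<close>

text \<open>Each term of the Leibniz expansion picks up every row factor and every column factor
  exactly once.\<close>

lemma det_scale_rows_cols: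
  fixes A :: "nat \<Rightarrow> nat \<Rightarrow> 'a :: comm_ring_1"
  shows "det (mat m m (\<lambda>(i, j). r i * A i j * c j)) =
    (\<Prod>i<m. r i) * (\<Prod>j<m. c j) * det (mat m m (\<lambda>(i, j). A i j))"
proof -
  have perm: "(\<Prod>i = 0..<m. r i * A i (p i) * c (p i)) =
      (\<Prod>i<m. r i) * (\<Prod>j<m. c j) * (\<Prod>i = 0..<m. A i (p i))"
    if p: "p permutes {0..<m}" for p
  proof -
    have "(\<Prod>i = 0..<m. c (p i)) = (\<Prod>i = 0..<m. c i)"
      using prod.permute[OF p, of c] by (simp add: o_def)
    then show ?thesis by (simp add: prod.distrib lessThan_atLeast0 mult_ac)
  qed
  have lt: "p i < m" if "p permutes {0..<m}" "i < m" for p i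
    using permutes_in_image[OF that(1), of i] that(2) by simp
  have "det (mat m m (\<lambda>(i, j). r i * A i j * c j)) =
      (\<Sum>p | p permutes {0..<m}. signof p * (\<Prod>i = 0..<m. r i * A i (p i) * c (p i)))"
    by (subst det_def'[of _ m]) (auto intro!: sum.cong prod.cong simp: lt)
  also have "\<dots> = (\<Sum>p | p permutes {0..<m}.
      (\<Prod>i<m. r i) * (\<Prod>j<m. c j) * (signof p * (\<Prod>i = 0..<m. A i (p i))))"
    by (intro sum.cong refl, subst perm) (simp_all add: mult_ac)
  also have "\<dots> = (\<Prod>i<m. r i) * (\<Prod>j<m. c j) * det (mat m m (\<lambda>(i, j). A i j))"
    by (subst det_def'[of _ m], simp, unfold sum_distrib_left)
      (auto intro!: sum.cong prod.cong arg_cong2[where f = "(*)"] simp: lt)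
  finally show ?thesis .
qed

lemma trace_conjugate:
  fixes B :: "'a :: comm_ring_1 mat"
  assumes "B \<in> carrier_mat m m" "P \<in> carrier_mat m m" "Q \<in> carrier_mat m m" "Q * P = 1\<^sub>m m"
  shows "(\<Sum>i<m. (P * B * Q) $$ (i, i)) = (\<Sum>i<m. B $$ (i, i))"
proof -
  have "(\<Sum>i<m. (P * B * Q) $$ (i, i)) =
      (\<Sum>i<m. \<Sum>l<m. \<Sum>j<m. P $$ (i, j) * B $$ (j, l) * Q $$ (l, i))"
    using assms by (intro sum.cong refl)
      (simp add: scalar_prod_def lessThan_atLeast0 sum_distrib_right del: assoc_mult_mat)
  also have "\<dots> = (\<Sum>j<m. \<Sum>l<m. B $$ (j, l) * (\<Sum>i<m. Q $$ (l, i) * P $$ (i, j)))"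
    unfolding sum_distrib_left
    by (subst sum.swap, subst sum.swap[of _ "{..<m}" "{..<m}"], subst (2) sum.swap)
      (intro sum.cong refl, simp add: mult_ac)
  also have "\<dots> = (\<Sum>j<m. \<Sum>l<m. B $$ (j, l) * (Q * P) $$ (l, j))"
    using assms(1-3) by (intro sum.cong refl) (simp add: scalar_prod_def lessThan_atLeast0)
  also have "\<dots> = (\<Sum>j<m. \<Sum>l<m. if l = j then B $$ (j, l) else 0)"
    unfolding assms(4) by (intro sum.cong refl) simp
  also have "\<dots> = (\<Sum>j<m. B $$ (j, j))" by (intro sum.cong refl) simp
  finally show ?thesis .
qed

text \<open>By Schur triangularization over the complex numbers, where the characteristic polynomial
  splits; trace and determinant are then read off the diagonal. The two parameters \<open>c\<close>
  and \<open>d\<close> cover both \<open>A\<close> itself and perturbations of the identity.\<close>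

lemma complex_eigenvalue_list:
  fixes A :: "complex mat"
  assumes A: "A \<in> carrier_mat m m"
  obtains es where "length es = m" "\<And>e. e \<in> set es \<Longrightarrow> eigenvalue A e"
    "sum_list es = (\<Sum>i<m. A $$ (i, i))"
    "\<And>c d. det (d \<cdot>\<^sub>m 1\<^sub>m m + c \<cdot>\<^sub>m A) = (\<Prod>e\<leftarrow>es. d + c * e)"
proof -
  obtain es where cp: "char_poly A = (\<Prod>e\<leftarrow>es. [:- e, 1:])" and len: "length es = m"
    using char_poly_factorized[OF A] by blast
  obtain B P Q where "schur_decomposition A es = (B, P, Q)"
    by (cases "schur_decomposition A es") auto
  from schur_decomposition[OF A cp this]
  have sim: "similar_mat_wit A B P Q" and ut: "upper_triangular B" and dg: "diag_mat B = es"
    by auto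
  note w = similar_mat_witD2[OF A sim]
  have carr: "B \<in> carrier_mat m m" "P \<in> carrier_mat m m" "Q \<in> carrier_mat m m" using w by auto
  show ?thesis
  proof (rule that[OF len])
    show "eigenvalue A e" if "e \<in> set es" for e
      unfolding eigenvalue_root_char_poly[OF A] cp
      using that by (auto simp: poly_prod_list prod_list_zero_iff o_def)
    show "sum_list es = (\<Sum>i<m. A $$ (i, i))"
      using trace_conjugate[OF carr(1,2,3) w(2)] w(3) carr(1) dg
      by (auto simp: diag_mat_def sum_list_sum_nth lessThan_atLeast0)
    show "det (d \<cdot>\<^sub>m 1\<^sub>m m + c \<cdot>\<^sub>m A) = (\<Prod>e\<leftarrow>es. d + c * e)" for c d
    proof -
      let ?D = "d \<cdot>\<^sub>m 1\<^sub>m m + c \<cdot>\<^sub>m B"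
      have D: "?D \<in> carrier_mat m m" using carr by simp
      have "d \<cdot>\<^sub>m 1\<^sub>m m + c \<cdot>\<^sub>m A = P * ?D * Q"
      proof -
        have "P * ?D * Q = (P * (d \<cdot>\<^sub>m 1\<^sub>m m) + P * (c \<cdot>\<^sub>m B)) * Q"
          using carr by (subst mult_add_distrib_mat[of _ m m _ m]) auto
        also have "\<dots> = P * (d \<cdot>\<^sub>m 1\<^sub>m m) * Q + P * (c \<cdot>\<^sub>m B) * Q"
          using carr by (intro add_mult_distrib_mat[of _ m m _ _ m]) auto
        finally have "P * ?D * Q = P * (d \<cdot>\<^sub>m 1\<^sub>m m) * Q + P * (c \<cdot>\<^sub>m B) * Q" .
        moreover have "P * (d \<cdot>\<^sub>m 1\<^sub>m m) * Q = d \<cdot>\<^sub>m 1\<^sub>m m"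
          using carr w(1) mult_smult_distrib[OF carr(2) one_carrier_mat, of d]
            mult_smult_assoc_mat[OF carr(2,3), of d] by simp
        moreover have "P * (c \<cdot>\<^sub>m B) * Q = c \<cdot>\<^sub>m A"
          using carr w(3) mult_smult_distrib[OF carr(2,1), of c]
            mult_smult_assoc_mat[of "P * B" m m Q m c] by simp
        ultimately show ?thesis by simp
      qed
      then have "det (d \<cdot>\<^sub>m 1\<^sub>m m + c \<cdot>\<^sub>m A) = det (Q * P) * det ?D"
        using carr D det_mult[OF carr(2) mult_carrier_mat[OF D carr(3)]] det_mult[OF D carr(3)] det_mult[OF carr(3,2)]
        by simp
      also have "\<dots> = det ?D" by (simp add: w(2))
      also have "\<dots> = prod_list (diag_mat ?D)"
        by (rule det_upper_triangular[OF _ D]) (use ut carr in \<open>auto simp: upper_triangular_def\<close>)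
      also have "diag_mat ?D = map (\<lambda>e. d + c * e) es"
        unfolding dg[symmetric] using carr by (auto simp: diag_mat_def)
      finally show ?thesis .
    qed
  qed
qed

text \<open>An eigenvalue satisfies \<open>e * e = a * e\<close>, so it is 0 or \<open>a\<close>,
  and the trace forces \<open>a\<close> to occur exactly \<open>p\<close> times.\<close>

lemma det_one_plus_quasi_idempotent:
  fixes K :: "real mat"
  assumes K: "K \<in> carrier_mat m m" and KK: "K * K = a \<cdot>\<^sub>m K" and a: "a \<noteq> 0"
    and tr: "(\<Sum>i<m. K $$ (i, i)) = a * real p"
  shows "det (1\<^sub>m m + c \<cdot>\<^sub>m K) = (1 + c * a) ^ p"
proof -
  let ?h = "map_mat complex_of_real"
  have C: "?h K \<in> carrier_mat m m" using K by simp
  obtain es where es: "length es = m" "\<And>e. e \<in> set es \<Longrightarrow> eigenvalue (?h K) e"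
    "sum_list es = (\<Sum>i<m. ?h K $$ (i, i))"
    "\<And>c d. det (d \<cdot>\<^sub>m 1\<^sub>m m + c \<cdot>\<^sub>m ?h K) = (\<Prod>e\<leftarrow>es. d + c * e)"
    using complex_eigenvalue_list[OF C] by blast
  have CC: "?h K * ?h K = of_real a \<cdot>\<^sub>m ?h K"
  proof -
    have "?h K * ?h K = ?h (a \<cdot>\<^sub>m K)" using of_real_hom.mat_hom_mult[OF K K] KK by metis
    also have "\<dots> = of_real a \<cdot>\<^sub>m ?h K" using K by (intro eq_matI) auto
    finally show ?thesis .
  qed
  have ev: "e = 0 \<or> e = of_real a" if e: "e \<in> set es" for e
  proof -
    obtain v where v: "v \<in> carrier_vec m" "v \<noteq> 0\<^sub>v m" "?h K *\<^sub>v v = e \<cdot>\<^sub>v v"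
      using es(2)[OF e] K unfolding eigenvalue_def eigenvector_def by auto
    have "(?h K * ?h K) *\<^sub>v v = (e * e) \<cdot>\<^sub>v v"
      using v C by (simp add: assoc_mult_mat_vec[of _ m m] mult_mat_vec[of _ m m] smult_smult_assoc)
    moreover have "(?h K * ?h K) *\<^sub>v v = (of_real a * e) \<cdot>\<^sub>v v"
    proof -
      have "(of_real a \<cdot>\<^sub>m ?h K) *\<^sub>v v = of_real a \<cdot>\<^sub>v (?h K *\<^sub>v v)"
        using v(1) K by (intro eq_vecI) (auto simp: scalar_prod_def sum_distrib_left mult_ac)
      then show ?thesis unfolding CC v(3) by (simp add: smult_smult_assoc)
    qed
    moreover obtain i where "i < m" "v $ i \<noteq> 0" using v(1,2) by (metis carrier_vecD eq_vecI index_zero_vec)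
    ultimately have "e * e = of_real a * e" using v(1)
      by (metis (no_types, lifting) carrier_vecD index_smult_vec(1) mult_right_cancel)
    then show ?thesis by auto
  qed
  have "(\<Sum>i<m. ?h K $$ (i, i)) = of_real (a * real p)"
    using K by (simp add: tr[symmetric] of_real_sum)
  then have "sum_list es = of_real a * of_nat p" using es(3) by simp
  \<comment> \<open>For a list with entries 0 and \<open>a\<close>, the sum and the product depend
    only on the number of nonzero entries; comparison with the trace identifies that number as
    \<open>p\<close>.\<close>
  moreover have "sum_list xs = of_real a * of_nat (length (filter (\<lambda>e. e \<noteq> 0) xs)) \<and>
     (\<Prod>e\<leftarrow>xs. 1 + of_real c * e) = (1 + of_real c * of_real a) ^ length (filter (\<lambda>e. e \<noteq> 0) xs)"
    if "\<And>e. e \<in> set xs \<Longrightarrow> e = 0 \<or> e = of_real a" for xs :: "complex list"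
    using that by (induction xs) (auto simp: algebra_simps a)
  note this[of es, OF ev]
  ultimately have "(\<Prod>e\<leftarrow>es. 1 + of_real c * e) = (1 + of_real c * complex_of_real a) ^ p"
    using a by auto
  moreover have "complex_of_real (det (1\<^sub>m m + c \<cdot>\<^sub>m K)) = (\<Prod>e\<leftarrow>es. 1 + of_real c * e)"
  proof -
    have "complex_of_real (det (1\<^sub>m m + c \<cdot>\<^sub>m K)) = det (?h (1\<^sub>m m + c \<cdot>\<^sub>m K))"
      by (simp add: of_real_hom.hom_det)
    also have "?h (1\<^sub>m m + c \<cdot>\<^sub>m K) = 1 \<cdot>\<^sub>m 1\<^sub>m m + of_real c \<cdot>\<^sub>m ?h K"
      using K by (intro eq_matI) auto
    finally show ?thesis using es(4)[of 1 "of_real c"] by simp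
  qed
  ultimately have "complex_of_real (det (1\<^sub>m m + c \<cdot>\<^sub>m K)) = of_real ((1 + c * a) ^ p)" by simp
  then show ?thesis using of_real_eq_iff by blast
qed

section \<open>Hadamard's inequality for Gram determinants\<close>

lemma quadratic_form_gram:
  fixes w :: "'a \<Rightarrow> nat \<Rightarrow> real" and v :: "nat \<Rightarrow> complex"
  shows "(\<Sum>i<m. cnj (v i) * (\<Sum>j<m. of_real (\<Sum>a\<in>S. w a i * w a j) * v j)) =
    of_real (\<Sum>a\<in>S. (cmod (\<Sum>j<m. of_real (w a j) * v j))\<^sup>2)"
proof -
  have "(\<Sum>i<m. cnj (v i) * (\<Sum>j<m. of_real (\<Sum>a\<in>S. w a i * w a j) * v j)) =
      (\<Sum>i<m. \<Sum>j<m. \<Sum>a\<in>S. of_real (w a i) * cnj (v i) * (of_real (w a j) * v j))"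
    by (simp add: sum_distrib_left sum_distrib_right mult_ac)
  also have "\<dots> = (\<Sum>i<m. \<Sum>a\<in>S. \<Sum>j<m. of_real (w a i) * cnj (v i) * (of_real (w a j) * v j))"
    by (intro sum.cong refl sum.swap)
  also have "\<dots> = (\<Sum>a\<in>S. \<Sum>i<m. \<Sum>j<m. of_real (w a i) * cnj (v i) * (of_real (w a j) * v j))"
    by (rule sum.swap)
  also have "\<dots> = (\<Sum>a\<in>S. cnj (\<Sum>i<m. of_real (w a i) * v i) * (\<Sum>j<m. of_real (w a j) * v j))"
    by (simp add: sum_product)
  also have "\<dots> = of_real (\<Sum>a\<in>S. (cmod (\<Sum>j<m. of_real (w a j) * v j))\<^sup>2)"
    unfolding of_real_sum by (intro sum.cong refl, subst complex_norm_square, subst mult.commute) simp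
  finally show ?thesis .
qed

text \<open>The Gram matrix is positive semidefinite with trace \<open>m\<close>, so its
  \<open>m\<close> eigenvalues are nonnegative with sum \<open>m\<close>, and the inequality of
  arithmetic and geometric means bounds their product by 1.\<close>

lemma hadamard_gram_normalized:
  fixes u :: "'a \<Rightarrow> nat \<Rightarrow> real"
  assumes norm: "\<And>i. i < m \<Longrightarrow> (\<Sum>a\<in>S. (u a i)\<^sup>2) = 1"
  shows "det (mat m m (\<lambda>(i, j). \<Sum>a\<in>S. u a i * u a j)) \<le> 1"
proof -
  define G where "G = mat m m (\<lambda>(i, j). \<Sum>a\<in>S. u a i * u a j)"
  let ?C = "map_mat complex_of_real G"
  have C: "?C \<in> carrier_mat m m" by (simp add: G_def)
  obtain es where es: "length es = m" "\<And>e. e \<in> set es \<Longrightarrow> eigenvalue ?C e"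
    "sum_list es = (\<Sum>i<m. ?C $$ (i, i))"
    "\<And>c d. det (d \<cdot>\<^sub>m 1\<^sub>m m + c \<cdot>\<^sub>m ?C) = (\<Prod>e\<leftarrow>es. d + c * e)"
    using complex_eigenvalue_list[OF C] by blast
  \<comment> \<open>One equation says that \<open>e\<close> is real and nonnegative. It comes from
    the Rayleigh quotient of an eigenvector, a sum of squares divided by a positive number.\<close>
  have ev: "e = of_real (cmod e)" if e: "e \<in> set es" for e
  proof -
    obtain v where v: "v \<in> carrier_vec m" "v \<noteq> 0\<^sub>v m" "?C *\<^sub>v v = e \<cdot>\<^sub>v v"
      using es(2)[OF e] C unfolding eigenvalue_def eigenvector_def by auto
    have row: "(\<Sum>j<m. of_real (\<Sum>a\<in>S. u a i * u a j) * v $ j) = e * v $ i" if "i < m" for i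
    proof -
      have "(?C *\<^sub>v v) $ i = (\<Sum>j<m. of_real (\<Sum>a\<in>S. u a i * u a j) * v $ j)"
        using that v(1) C by (auto simp: scalar_prod_def lessThan_atLeast0 G_def intro!: sum.cong)
      then show ?thesis using v that by simp
    qed
    let ?N = "\<Sum>i<m. (cmod (v $ i))\<^sup>2"
    let ?R = "\<Sum>a\<in>S. (cmod (\<Sum>j<m. of_real (u a j) * v $ j))\<^sup>2"
    have "e * of_real ?N = (\<Sum>i<m. cnj (v $ i) * (e * v $ i))"
      unfolding of_real_sum sum_distrib_left
      by (intro sum.cong refl) (simp add: complex_norm_square mult_ac flip: of_real_power)
    also have "\<dots> = of_real ?R" unfolding quadratic_form_gram[symmetric] by (intro sum.cong refl) (simp only: row lessThan_iff)
    finally have eN: "e * of_real ?N = of_real ?R" .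
    obtain i where "i < m" "v $ i \<noteq> 0" using v(1,2) by (metis carrier_vecD eq_vecI index_zero_vec)
    then have N: "?N > 0" by (intro sum_pos2[of _ i]) auto
    have "e = of_real (?R / ?N)"
    proof -
      have "complex_of_real ?N \<noteq> 0" using N by (metis less_irrefl of_real_eq_0_iff)
      from nonzero_eq_divide_eq[OF this] show ?thesis unfolding of_real_divide using eN by blast
    qed
    moreover have "?R / ?N \<ge> 0" using N by (intro divide_nonneg_pos sum_nonneg) auto
    ultimately have "cmod e = ?R / ?N" by (simp only: norm_of_real abs_of_nonneg)
    then show ?thesis using \<open>e = of_real (?R / ?N)\<close> by (rule ssubst)
  qed
  have "complex_of_real (sum_list (map cmod es)) = sum_list es"
    using ev by (induction es) auto
  also have "\<dots> = of_real (\<Sum>i<m. \<Sum>a\<in>S. (u a i)\<^sup>2)"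
    unfolding es(3) by (simp add: G_def power2_eq_square)
  finally have tr: "sum_list (map cmod es) = real m"
    using norm by (simp only: of_real_eq_iff) simp
  \<comment> \<open>The inequality of means in exponential form: each factor satisfies
    \<open>t \<le> exp (t - 1)\<close>, and the exponents add up to the trace minus the length,
    which is 0.\<close>
  have "prod_list (map cmod es) \<le> exp (sum_list (map cmod es) - real (length es))"
  proof (induction es)
    case (Cons e es)
    have "cmod e \<le> exp (cmod e - 1)" using exp_ge_add_one_self[of "cmod e - 1"] by simp
    then have "cmod e * prod_list (map cmod es) \<le>
        exp (cmod e - 1) * exp (sum_list (map cmod es) - real (length es))"
      using Cons by (intro mult_mono) (auto intro!: prod_list_nonneg)
    then show ?case by (simp add: algebra_simps flip: exp_add)
  qed simp
  then have bound: "prod_list (map cmod es) \<le> 1" using tr es(1) by simp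
  have "complex_of_real (det G) = det ?C" by (simp add: of_real_hom.hom_det)
  also have "\<dots> = prod_list es"
  proof -
    have "0 \<cdot>\<^sub>m 1\<^sub>m m + 1 \<cdot>\<^sub>m ?C = ?C" using C by (intro eq_matI) auto
    then show ?thesis using es(4)[of 0 1] by simp
  qed
  finally have "\<bar>det G\<bar> = cmod (prod_list es)" by (metis norm_of_real)
  also have "cmod (prod_list es) = prod_list (map cmod es)"
    by (induction es) (auto simp: norm_mult)
  finally show ?thesis using bound unfolding G_def by linarith
qed

text \<open>Reduction to unit columns: dividing column \<open>i\<close> by its norm
  \<open>d i\<close> takes the factor \<open>(d i)\<^sup>2\<close> out of the Gram
  determinant.\<close>

lemma hadamard_gram:
  fixes w :: "'a \<Rightarrow> nat \<Rightarrow> real"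
  assumes pos: "\<And>i. i < m \<Longrightarrow> (\<Sum>a\<in>S. (w a i)\<^sup>2) > 0"
  shows "det (mat m m (\<lambda>(i, j). \<Sum>a\<in>S. w a i * w a j)) \<le> (\<Prod>i<m. \<Sum>a\<in>S. (w a i)\<^sup>2)"
proof -
  define d where "d i = sqrt (\<Sum>a\<in>S. (w a i)\<^sup>2)" for i
  define u where "u a i = w a i / d i" for a i
  have d: "d i > 0" if "i < m" for i using pos[OF that] by (simp add: d_def)
  then have d0: "d i \<noteq> 0" if "i < m" for i using that by fastforce
  have d2: "(d i)\<^sup>2 = (\<Sum>a\<in>S. (w a i)\<^sup>2)" for i by (simp add: d_def sum_nonneg)
  have "mat m m (\<lambda>(i, j). \<Sum>a\<in>S. w a i * w a j) =
      mat m m (\<lambda>(i, j). d i * (\<Sum>a\<in>S. u a i * u a j) * d j)"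
    by (intro eq_matI)
      (auto simp: u_def sum_distrib_left sum_distrib_right d0 intro!: sum.cong)
  then have "det (mat m m (\<lambda>(i, j). \<Sum>a\<in>S. w a i * w a j)) =
      (\<Prod>i<m. (d i)\<^sup>2) * det (mat m m (\<lambda>(i, j). \<Sum>a\<in>S. u a i * u a j))"
    by (simp add: det_scale_rows_cols power2_eq_square prod.distrib)
  also have "\<dots> \<le> (\<Prod>i<m. (d i)\<^sup>2) * 1"
  proof (intro mult_left_mono hadamard_gram_normalized prod_nonneg)
    show "(\<Sum>a\<in>S. (u a i)\<^sup>2) = 1" if "i < m" for i
    proof -
      have "(\<Sum>a\<in>S. (u a i)\<^sup>2) = (\<Sum>a\<in>S. (w a i)\<^sup>2) / (d i)\<^sup>2"
        by (simp add: u_def power_divide sum_divide_distrib)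
      then show ?thesis using pos[OF that] d2[of i] by simp
    qed
  qed auto
  finally show ?thesis by (simp add: d2)
qed

subsection \<open>Index of an integer lattice\<close>

text \<open>The proof replaces the columns of the matrix by a triangular basis of the lattice they
  span; the transversal is then the box spanned by the diagonal.\<close>
lemma lattice_transversal:
  fixes A :: "nat \<Rightarrow> nat \<Rightarrow> int"
  assumes det0: "det (mat m m (\<lambda>(i, j). A i j)) \<noteq> 0"
  obtains R where "finite R" "int (card R) \<le> \<bar>det (mat m m (\<lambda>(i, j). A i j))\<bar>"
    "\<And>v. \<exists>r\<in>R. \<exists>z. \<forall>j<m. v j - r j = (\<Sum>l<m. A j l * z l)"
proof -
  define L where "L = {\<lambda>j. \<Sum>l<m. A j l * z l | z. True}"
  have L_diff: "(\<lambda>j. f j - c * g j) \<in> L" if fg: "f \<in> L" "g \<in> L" for f g c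
  proof -
    obtain y z where "f = (\<lambda>j. \<Sum>l<m. A j l * y l)" "g = (\<lambda>j. \<Sum>l<m. A j l * z l)"
      using fg by (auto simp: L_def)
    then have "(\<lambda>j. f j - c * g j) = (\<lambda>j. \<Sum>l<m. A j l * (y l - c * z l))"
      by (simp add: fun_eq_iff sum_distrib_left sum_subtractf algebra_simps)
    then show ?thesis by (auto simp: L_def)
  qed
  have L_zero: "(\<lambda>j. 0) \<in> L"
    unfolding L_def by (intro CollectI exI[of _ "\<lambda>_. 0"]) simp
  have L_col: "(\<lambda>j. A j l) \<in> L" if "l < m" for l
    unfolding L_def using that
    by (intro CollectI exI[of _ "\<lambda>i. if i = l then 1 else 0"]) (simp add: if_distrib cong: if_cong)
  \<comment> \<open>The entries at position \<open>i\<close> of the vectors in \<open>Lt i\<close>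
    form an ideal of the integers; a vector attaining a generator becomes the \<open>i\<close>-th
    vector of the triangular basis.\<close>
  define Lt where "Lt i = {f \<in> L. \<forall>j<i. f j = 0}" for i
  have "\<exists>h\<in>Lt i. \<forall>f\<in>Lt i. h i dvd f i" for i
  proof (cases "\<forall>f\<in>Lt i. f i = 0")
    case True
    then show ?thesis using L_zero by (intro bexI[of _ "\<lambda>j. 0"]) (auto simp: Lt_def)
  next
    case False
    \<comment> \<open>A nonzero entry of least absolute value generates the ideal, since a nonzero
      division remainder would be smaller.\<close>
    define P where "P h \<longleftrightarrow> h \<in> Lt i \<and> h i \<noteq> 0" for h
    obtain h where h: "P h" "\<And>g. P g \<Longrightarrow> nat \<bar>h i\<bar> \<le> nat \<bar>g i\<bar>"
      using False ex_has_least_nat[of P _ "\<lambda>h. nat \<bar>h i\<bar>"] unfolding P_def by blast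
    have "h i dvd f i" if f: "f \<in> Lt i" for f
    proof (rule ccontr)
      assume "\<not> h i dvd f i"
      then have ne: "f i mod h i \<noteq> 0" by (simp add: dvd_eq_mod_eq_0)
      let ?g = "\<lambda>j. f j - (f i div h i) * h j"
      have gi: "?g i = f i mod h i" by (simp add: minus_div_mult_eq_mod)
      have "?g \<in> Lt i" using f h(1) L_diff by (auto simp: Lt_def P_def)
      then have "P ?g" using ne gi by (simp add: P_def)
      from h(2)[OF this] have "\<bar>h i\<bar> \<le> \<bar>f i mod h i\<bar>" unfolding gi by simp
      moreover have "\<bar>f i mod h i\<bar> < \<bar>h i\<bar>"
        using h(1) by (intro abs_mod_less) (simp add: P_def)
      ultimately show False by simp
    qed
    then show ?thesis using h(1) by (auto simp: P_def)
  qed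
  then obtain h where h: "\<And>i. h i \<in> Lt i" "\<And>i f. f \<in> Lt i \<Longrightarrow> h i i dvd f i" by metis
  have hL: "h i \<in> L" and h0: "\<And>j. j < i \<Longrightarrow> h i j = 0" for i using h(1)[of i] by (auto simp: Lt_def)
  \<comment> \<open>Elimination with the pivots: \<open>t\<close> steps clear the first
    \<open>t\<close> coordinates, so for \<open>t = m\<close> only the combination of the
    \<open>h i\<close> is left in the coordinates below \<open>m\<close>.\<close>
  have expand: "\<exists>c. \<exists>w\<in>Lt t. \<forall>j. f j = w j + (\<Sum>i<t. h i j * c i)" if f: "f \<in> L" for f t
  proof (induction t)
    case 0
    show ?case using f by (auto simp: Lt_def)
  next
    case (Suc t)
    then obtain c w where w: "w \<in> Lt t" "\<And>j. f j = w j + (\<Sum>i<t. h i j * c i)" by blast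
    obtain q where q: "w t = h t t * q" using h(2)[OF w(1)] by (auto elim: dvdE)
    let ?w = "\<lambda>j. w j - q * h t j"
    have "?w \<in> Lt (Suc t)" using w(1) h(1)[of t] q L_diff by (auto simp: Lt_def less_Suc_eq)
    moreover have "f j = ?w j + (\<Sum>i<Suc t. h i j * (c(t := q)) i)" for j
      by (simp add: w(2))
    ultimately have "\<exists>w\<in>Lt (Suc t). \<forall>j. f j = w j + (\<Sum>i<Suc t. h i j * (c(t := q)) i)"
      by (intro bexI[of _ ?w]) simp_all
    then show ?case by (rule exI[of _ "c(t := q)"])
  qed
  have "\<exists>c. \<forall>j<m. f j = (\<Sum>i<m. h i j * c i)" if "f \<in> L" for f
    using expand[OF that, of m] by (auto simp: Lt_def)
  then have "\<exists>c. \<forall>j<m. A j l = (\<Sum>i<m. h i j * c i)" if "l < m" for l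
    using L_col[OF that] by blast
  then obtain c where c: "\<And>l j. l < m \<Longrightarrow> j < m \<Longrightarrow> A j l = (\<Sum>i<m. h i j * c l i)" by metis
  define H where "H = mat m m (\<lambda>(j, i). h i j)"
  define C where "C = mat m m (\<lambda>(i, l). c l i)"
  have HC: "mat m m (\<lambda>(i, j). A i j) = H * C"
    by (intro eq_matI) (auto simp: H_def C_def scalar_prod_def c lessThan_atLeast0)
  then have detHC: "det (mat m m (\<lambda>(i, j). A i j)) = det H * det C"
    by (simp add: det_mult[of _ m] H_def C_def)
  have "det H = prod_list (diag_mat H)"
    by (rule det_lower_triangular[of m]) (auto simp: H_def h0)
  then have detH: "det H = (\<Prod>i<m. h i i)"
    by (simp add: prod_list_diag_prod H_def lessThan_atLeast0)
  \<comment> \<open>A zero pivot would make \<open>det H\<close>, and with it the determinant of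
    \<open>A\<close>, vanish.\<close>
  have hpos: "h i i \<noteq> 0" if "i < m" for i
    using det0 detHC detH that by auto
  define Bx where "Bx = PiE {..<m} (\<lambda>j. {0..<\<bar>h j j\<bar>})"
  have fin: "finite Bx" unfolding Bx_def by (intro finite_PiE) auto
  have "int (card Bx) = (\<Prod>i<m. \<bar>h i i\<bar>)" unfolding Bx_def by (simp add: card_PiE)
  also have "\<dots> = \<bar>det H\<bar>" by (simp add: detH abs_prod)
  \<comment> \<open>\<open>det C\<close> is a nonzero integer, so its absolute value is at least
    1.\<close>
  also have "\<dots> \<le> \<bar>det H\<bar> * \<bar>det C\<bar>"
    using det0 detHC by (intro mult_le_cancel_left1[THEN iffD2]) auto
  also have "\<dots> = \<bar>det (mat m m (\<lambda>(i, j). A i j))\<bar>" by (simp add: detHC abs_mult)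
  finally have cardB: "int (card Bx) \<le> \<bar>det (mat m m (\<lambda>(i, j). A i j))\<bar>" .
  \<comment> \<open>Coordinates are reduced in increasing order; subtracting a multiple of
    \<open>h t\<close> leaves the earlier ones intact because \<open>h t\<close> vanishes
    there.\<close>
  have reduce: "\<exists>w. (\<lambda>j. v j - w j) \<in> L \<and> (\<forall>j<t. w j \<in> {0..<\<bar>h j j\<bar>})"
    if "t \<le> m" for v t
    using that
  proof (induction t)
    case 0
    show ?case using L_zero by (intro exI[of _ v]) simp
  next
    case (Suc t)
    then obtain w where w: "(\<lambda>j. v j - w j) \<in> L" "\<forall>j<t. w j \<in> {0..<\<bar>h j j\<bar>}" by auto
    \<comment> \<open>The sign makes the new coordinate a remainder modulo
      \<open>\<bar>h t t\<bar>\<close>, hence nonnegative also for a negative pivot.\<close>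
    define q where "q = sgn (h t t) * (w t div \<bar>h t t\<bar>)"
    let ?w = "\<lambda>j. w j - q * h t j"
    have "?w t = w t mod \<bar>h t t\<bar>"
    proof -
      have "q * h t t = \<bar>h t t\<bar> * (w t div \<bar>h t t\<bar>)"
        by (simp add: q_def abs_sgn mult_ac)
      then show ?thesis by (simp add: minus_mult_div_eq_mod)
    qed
    then have "?w t \<in> {0..<\<bar>h t t\<bar>}" using hpos[of t] Suc.prems by simp
    then have "\<forall>j<Suc t. ?w j \<in> {0..<\<bar>h j j\<bar>}" using w(2) by (auto simp: less_Suc_eq h0)
    moreover have "(\<lambda>j. v j - ?w j) \<in> L"
      using L_diff[OF w(1) hL[of t], of "- q"] by (simp add: algebra_simps)
    ultimately show ?case by (intro exI[of _ ?w] conjI)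
  qed
  show ?thesis
  proof (rule that[OF fin cardB])
    fix v :: "nat \<Rightarrow> int"
    obtain w where w: "(\<lambda>j. v j - w j) \<in> L" "\<And>j. j < m \<Longrightarrow> w j \<in> {0..<\<bar>h j j\<bar>}"
      using reduce[of m v] by blast
    then obtain z where z: "\<And>j. v j - w j = (\<Sum>l<m. A j l * z l)"
      unfolding L_def by (auto simp: fun_eq_iff)
    show "\<exists>r\<in>Bx. \<exists>z. \<forall>j<m. v j - r j = (\<Sum>l<m. A j l * z l)"
    proof (rule bexI)
      \<comment> \<open>\<open>restrict\<close> supplies the \<open>undefined\<close> values outside
        the index set that membership in \<open>PiE\<close> requires.\<close>
      show "restrict w {..<m} \<in> Bx" unfolding Bx_def using w(2) by (auto simp: PiE_iff)
      show "\<exists>za. \<forall>j<m. v j - restrict w {..<m} j = (\<Sum>l<m. A j l * za l)"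
        using z by (intro exI[of _ z]) simp
    qed
  qed
qed

subsection \<open>Weighted simplicial boundary\<close>

text \<open>Interior product with the vector \<open>x\<close> on the exterior algebra over
  \<open>V\<close>, with faces as basis monomials; for the constant weight 1 it is the simplicial
  boundary. The type class covers integers and reals alike.\<close>

definition contraction :: "nat set \<Rightarrow> (nat \<Rightarrow> 'a :: linordered_idom) \<Rightarrow> (nat set \<Rightarrow> 'a) \<Rightarrow> nat set \<Rightarrow> 'a" where
  "contraction V x c B = (\<Sum>v\<in>V - B. of_int (bd_sign v B) * x v * c (insert v B))"

text \<open>Exterior multiplication by the vector \<open>x\<close>, the adjoint of
  \<open>contraction\<close>.\<close>

definition wedge :: "(nat \<Rightarrow> 'a :: linordered_idom) \<Rightarrow> (nat set \<Rightarrow> 'a) \<Rightarrow> nat set \<Rightarrow> 'a" where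
  "wedge x c A = (\<Sum>v\<in>A. of_int (bd_sign v (A - {v})) * x v * c (A - {v}))"

text \<open>Matrix entry of \<open>contraction\<close> in row \<open>B\<close> and column
  \<open>A\<close>. Writing a column as the contraction of a basis vector makes
  \<open>contraction_contraction\<close> applicable to columns.\<close>

definition weighted_bd :: "nat set \<Rightarrow> (nat \<Rightarrow> 'a :: linordered_idom) \<Rightarrow> nat set \<Rightarrow> nat set \<Rightarrow> 'a" where
  "weighted_bd V x B A = contraction V x (\<lambda>C. if C = A then 1 else 0) B"

definition subsets_of_size :: "nat set \<Rightarrow> nat \<Rightarrow> nat set set" where
  "subsets_of_size V j = {A. A \<subseteq> V \<and> card A = j}"

lemma finite_subsets_of_size: "finite V \<Longrightarrow> finite (subsets_of_size V j)"
  unfolding subsets_of_size_def by (rule finite_subset[of _ "Pow V"]) auto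

lemma card_subsets_of_size: "finite V \<Longrightarrow> card (subsets_of_size V j) = card V choose j"
  unfolding subsets_of_size_def by (rule n_subsets)

lemma bd_sign_insert:
  assumes "finite B" "v \<notin> B"
  shows "bd_sign u (insert v B) = (if v < u then - bd_sign u B else bd_sign u B)"
proof (cases "v < u")
  case True
  then have "{w \<in> insert v B. w < u} = insert v {w \<in> B. w < u}" by auto
  then show ?thesis using assms True by (simp add: bd_sign_def)
next
  case False
  then have "{w \<in> insert v B. w < u} = {w \<in> B. w < u}" by auto
  then show ?thesis using False by (simp add: bd_sign_def)
qed

lemma bd_sign_square: "bd_sign v B * bd_sign v B = 1"
  by (simp add: bd_sign_def flip: power_add mult_2)

text \<open>The double sum is antisymmetric in the two inserted vertices, since inserting the
  smaller one flips the sign of the larger one and not conversely. Hence it equals its own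
  negative.\<close>

lemma contraction_contraction:
  assumes V: "finite V" and B: "B \<subseteq> V"
  shows "contraction V x (contraction V x c) B = 0"
proof -
  have fB: "finite B" using V B finite_subset by blast
  \<comment> \<open>The diagonal is set to 0 so that both indices can range over all of
    \<open>V - B\<close>.\<close>
  define g where "g v u = (if u = v then 0 else of_int (bd_sign v B * bd_sign u (insert v B)) *
    x v * x u * c (insert u (insert v B)))" for v u
  have anti: "g v u = - g u v" if "v \<notin> B" "u \<notin> B" for u v
    using that fB by (auto simp: g_def bd_sign_insert insert_commute mult_ac)
  have "contraction V x (contraction V x c) B = (\<Sum>v\<in>V - B. \<Sum>u\<in>V - insert v B. g v u)"
    unfolding contraction_def sum_distrib_left
    by (intro sum.cong refl) (auto simp: g_def mult_ac)
  also have "\<dots> = (\<Sum>v\<in>V - B. \<Sum>u\<in>V - B. g v u)"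
    by (intro sum.cong refl sum.mono_neutral_left) (use V in \<open>auto simp: g_def\<close>)
  finally have eq: "contraction V x (contraction V x c) B = (\<Sum>v\<in>V - B. \<Sum>u\<in>V - B. g v u)" .
  also have "\<dots> = (\<Sum>v\<in>V - B. \<Sum>u\<in>V - B. - g u v)"
    by (intro sum.cong refl anti) auto
  also have "\<dots> = - (\<Sum>v\<in>V - B. \<Sum>u\<in>V - B. g v u)"
    by (subst sum.swap) (simp add: sum_negf)
  finally show ?thesis unfolding eq by simp
qed

text \<open>Contracting a wedge gives the squares for the vertices outside \<open>B\<close>, wedging
  a contraction those for the vertices in \<open>B\<close>; the mixed terms occur in both sums with
  opposite signs.\<close>

lemma koszul_identity:
  fixes x :: "nat \<Rightarrow> 'a :: linordered_idom"
  assumes V: "finite V" and B: "B \<subseteq> V"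
  shows "contraction V x (wedge x c) B + wedge x (contraction V x c) B = (\<Sum>v\<in>V. (x v)\<^sup>2) * c B"
proof -
  have fB: "finite B" using V B finite_subset by blast
  \<comment> \<open>The mixed term that trades a vertex \<open>u\<close> of \<open>B\<close> for a
    vertex \<open>v\<close> outside \<open>B\<close>.\<close>
  define g where "g v u = of_int (bd_sign v (B - {u}) * bd_sign u (B - {u})) *
    x v * x u * c (insert v (B - {u}))" for v u
  have sq: "of_int (bd_sign v C) * of_int (bd_sign v C) = (1 :: 'a)" for v C
    by (simp add: bd_sign_square flip: of_int_mult)
  have sq': "of_int (bd_sign v C) * (of_int (bd_sign v C) * y) = y" for v C and y :: 'a
    by (simp add: sq flip: mult.assoc)
  have "contraction V x (wedge x c) B = (\<Sum>v\<in>V - B. (x v)\<^sup>2 * c B - (\<Sum>u\<in>B. g v u))"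
    unfolding contraction_def
  proof (intro sum.cong refl)
    fix v assume v: "v \<in> V - B"
    have "of_int (bd_sign v B) * x v * (of_int (bd_sign u (insert v B - {u})) * x u * c (insert v B - {u}))
        = - g v u" if u: "u \<in> B" for u
    proof -
      have ne: "u \<noteq> v" and e: "insert v B - {u} = insert v (B - {u})" "insert u (B - {u}) = B"
        using u v by auto
      have "bd_sign v B = (if u < v then - bd_sign v (B - {u}) else bd_sign v (B - {u}))"
        using bd_sign_insert[of "B - {u}" u v] fB unfolding e(2) by simp
      moreover have "bd_sign u (insert v (B - {u})) =
          (if v < u then - bd_sign u (B - {u}) else bd_sign u (B - {u}))"
        using v fB by (intro bd_sign_insert) auto
      ultimately show ?thesis using ne unfolding e(1) g_def by (auto simp: mult_ac)
    qed
    moreover have "wedge x c (insert v B) = of_int (bd_sign v B) * x v * c B +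
        (\<Sum>u\<in>B. of_int (bd_sign u (insert v B - {u})) * x u * c (insert v B - {u}))"
      using v fB unfolding wedge_def by (subst sum.insert) auto
    ultimately show "of_int (bd_sign v B) * x v * wedge x c (insert v B) =
        (x v)\<^sup>2 * c B - (\<Sum>u\<in>B. g v u)"
      by (simp add: distrib_left sum_distrib_left sum_negf power2_eq_square)
        (simp add: mult_ac sq sq')
  qed
  moreover have "wedge x (contraction V x c) B = (\<Sum>u\<in>B. (x u)\<^sup>2 * c B + (\<Sum>v\<in>V - B. g v u))"
    unfolding wedge_def
  proof (intro sum.cong refl)
    fix u assume u: "u \<in> B"
    have "V - (B - {u}) = insert u (V - B)" "insert u (B - {u}) = B" using u B by auto
    then show "of_int (bd_sign u (B - {u})) * x u * contraction V x c (B - {u}) =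
        (x u)\<^sup>2 * c B + (\<Sum>v\<in>V - B. g v u)"
      using V u unfolding contraction_def g_def
      by (simp add: distrib_left sum_distrib_left power2_eq_square) (simp add: mult_ac sq sq')
  qed
  moreover have "(\<Sum>v\<in>V. (x v)\<^sup>2) = (\<Sum>v\<in>V - B. (x v)\<^sup>2) + (\<Sum>v\<in>B. (x v)\<^sup>2)"
    using sum.subset_diff[OF B V] .
  moreover have "(\<Sum>u\<in>B. \<Sum>v\<in>V - B. g v u) = (\<Sum>v\<in>V - B. \<Sum>u\<in>B. g v u)" by (rule sum.swap)
  ultimately show ?thesis
    by (simp add: sum.distrib sum_subtractf sum_distrib_right distrib_right)
qed

section \<open>The weighted boundary matrix and its Laplacian\<close>

lemma contraction_eq_sum_weighted_bd:
  assumes V: "finite V" and B: "B \<in> subsets_of_size V j"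
  shows "contraction V x c B = (\<Sum>A\<in>subsets_of_size V (Suc j). weighted_bd V x B A * c A)"
proof -
  have fB: "finite B" using V B finite_subset by (auto simp: subsets_of_size_def)
  have "(\<Sum>A\<in>subsets_of_size V (Suc j). weighted_bd V x B A * c A) =
      (\<Sum>v\<in>V - B. \<Sum>A\<in>subsets_of_size V (Suc j).
        of_int (bd_sign v B) * x v * (if insert v B = A then 1 else 0) * c A)"
    unfolding weighted_bd_def contraction_def sum_distrib_right by (rule sum.swap)
  also have "\<dots> = (\<Sum>v\<in>V - B. of_int (bd_sign v B) * x v * c (insert v B))"
  proof (intro sum.cong refl)
    fix v assume "v \<in> V - B"
    then have "insert v B \<in> subsets_of_size V (Suc j)"
      using B fB by (auto simp: subsets_of_size_def)
    moreover have "(\<Sum>A\<in>subsets_of_size V (Suc j).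
        of_int (bd_sign v B) * x v * (if insert v B = A then 1 else 0) * c A) =
        (\<Sum>A\<in>subsets_of_size V (Suc j). if insert v B = A then of_int (bd_sign v B) * x v * c A else 0)"
      by (intro sum.cong refl) simp
    ultimately show "(\<Sum>A\<in>subsets_of_size V (Suc j).
        of_int (bd_sign v B) * x v * (if insert v B = A then 1 else 0) * c A) =
        of_int (bd_sign v B) * x v * c (insert v B)"
      by (simp add: finite_subsets_of_size[OF V])
  qed
  finally show ?thesis by (simp add: contraction_def)
qed

lemma weighted_bd_remove:
  assumes "finite V" "A \<subseteq> V" "v \<in> A"
  shows "weighted_bd V x (A - {v}) A = of_int (bd_sign v (A - {v})) * x v"
proof -
  have e: "V - (A - {v}) = insert v (V - A)" using assms by auto
  have n: "insert u (A - {v}) \<noteq> A" if "u \<in> V - A" for u using that assms by auto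
  show ?thesis unfolding weighted_bd_def contraction_def e using assms n
    by (subst sum.insert) (auto simp: insert_absorb intro!: sum.neutral)
qed

lemma weighted_bd_eq_0:
  assumes "\<And>v. v \<in> A \<Longrightarrow> B \<noteq> A - {v}"
  shows "weighted_bd V x B A = 0"
  unfolding weighted_bd_def contraction_def using assms by (intro sum.neutral) fastforce

text \<open>The same matrix as for \<open>contraction\<close>, now summed over its rows:
  \<open>wedge\<close> is the transposed operator.\<close>

lemma wedge_eq_sum_weighted_bd:
  assumes V: "finite V" and A: "A \<in> subsets_of_size V (Suc j)"
  shows "wedge x c A = (\<Sum>B\<in>subsets_of_size V j. weighted_bd V x B A * c B)"
proof -
  have AV: "A \<subseteq> V" and cA: "card A = Suc j" using A by (auto simp: subsets_of_size_def)
  have fA: "finite A" using V AV finite_subset by blast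
  have inj: "inj_on (\<lambda>v. A - {v}) A" by (auto simp: inj_on_def)
  have sub: "(\<lambda>v. A - {v}) ` A \<subseteq> subsets_of_size V j"
    using AV cA fA by (auto simp: subsets_of_size_def)
  have "(\<Sum>B\<in>subsets_of_size V j. weighted_bd V x B A * c B) =
      (\<Sum>B\<in>(\<lambda>v. A - {v}) ` A. weighted_bd V x B A * c B)"
    using sub V by (intro sum.mono_neutral_right) (auto simp: finite_subsets_of_size intro!: weighted_bd_eq_0)
  also have "\<dots> = wedge x c A"
    unfolding wedge_def by (subst sum.reindex[OF inj]) (auto simp: weighted_bd_remove V AV intro!: sum.cong)
  finally show ?thesis by simp
qed

text \<open>The column of \<open>A\<close> has an entry of absolute value
  \<open>\<bar>x v\<bar>\<close> at each \<open>A - {v}\<close> and 0 elsewhere; wedging this column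
  and evaluating at \<open>A\<close> collects the squares.\<close>

lemma sum_weighted_bd_squares:
  assumes V: "finite V" and A: "A \<in> subsets_of_size V (Suc j)"
  shows "(\<Sum>B\<in>subsets_of_size V j. (weighted_bd V x B A)\<^sup>2) = (\<Sum>v\<in>A. (x v)\<^sup>2)"
proof -
  have AV: "A \<subseteq> V" using A by (auto simp: subsets_of_size_def)
  have "(\<Sum>B\<in>subsets_of_size V j. (weighted_bd V x B A)\<^sup>2) = wedge x (\<lambda>B. weighted_bd V x B A) A"
    by (simp add: wedge_eq_sum_weighted_bd[OF assms] power2_eq_square)
  also have "\<dots> = (\<Sum>v\<in>A. (x v)\<^sup>2)"
    unfolding wedge_def
  proof (intro sum.cong refl)
    fix v assume "v \<in> A"
    then have "of_int (bd_sign v (A - {v})) * x v * weighted_bd V x (A - {v}) A =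
        of_int (bd_sign v (A - {v}) * bd_sign v (A - {v})) * (x v)\<^sup>2"
      by (simp add: weighted_bd_remove V AV power2_eq_square mult_ac)
    then show "of_int (bd_sign v (A - {v})) * x v * weighted_bd V x (A - {v}) A = (x v)\<^sup>2"
      by (simp only: bd_sign_square) simp
  qed
  finally show ?thesis .
qed

text \<open>For \<open>B = A - {v}\<close> the factor \<open>x v\<close> of the entry completes the
  monomial of \<open>B\<close> to that of \<open>A\<close>. This links the weighted matrix with the
  integer boundary matrix.\<close>

lemma weighted_bd_rescale:
  assumes "finite V" "B \<subseteq> V"
  shows "(\<Prod>v\<in>B. x v) * weighted_bd V x B A = weighted_bd V (\<lambda>_. 1) B A * (\<Prod>v\<in>A. x v)"
proof -
  have "finite B" using assms finite_subset by blast
  then show ?thesis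
    unfolding weighted_bd_def contraction_def sum_distrib_left sum_distrib_right
    by (intro sum.cong refl) (auto simp: mult_ac)
qed

text \<open>A column of the matrix is itself a contraction, so a further contraction kills it and
  only one term of the Koszul identity survives; applying the transposed matrix then gives the
  claim.\<close>

lemma weighted_bd_laplacian_square:
  fixes x :: "nat \<Rightarrow> 'a :: linordered_idom"
  assumes V: "finite V" and F: "F \<in> subsets_of_size V (Suc j)" "F' \<in> subsets_of_size V (Suc j)"
  defines "K \<equiv> \<lambda>F F'. \<Sum>G\<in>subsets_of_size V j. weighted_bd V x G F * weighted_bd V x G F'"
  shows "(\<Sum>H\<in>subsets_of_size V (Suc j). K F H * K H F') = (\<Sum>v\<in>V. (x v)\<^sup>2) * K F F'"
proof -
  let ?S = "subsets_of_size V (Suc j)" and ?R = "subsets_of_size V j"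
  let ?d = "\<lambda>G. weighted_bd V x G F'"
  have KH: "K H F' = wedge x ?d H" if "H \<in> ?S" for H
    unfolding K_def wedge_eq_sum_weighted_bd[OF V that] ..
  have "(\<Sum>H\<in>?S. K F H * K H F') = (\<Sum>H\<in>?S. \<Sum>G\<in>?R. weighted_bd V x G F * (weighted_bd V x G H * wedge x ?d H))"
    by (intro sum.cong refl) (simp add: KH, simp add: K_def sum_distrib_left mult_ac)
  also have "\<dots> = (\<Sum>G\<in>?R. weighted_bd V x G F * contraction V x (wedge x ?d) G)"
    by (subst sum.swap) (simp add: contraction_eq_sum_weighted_bd[OF V] sum_distrib_left)
  also have "\<dots> = (\<Sum>G\<in>?R. weighted_bd V x G F * ((\<Sum>v\<in>V. (x v)\<^sup>2) * ?d G))"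
  proof (intro sum.cong refl arg_cong2[where f = "(*)"])
    fix G assume "G \<in> ?R"
    then have G: "G \<subseteq> V" by (auto simp: subsets_of_size_def)
    have "contraction V x ?d (G - {v}) = 0" for v
      unfolding weighted_bd_def by (rule contraction_contraction) (use V G in auto)
    then have "wedge x (contraction V x ?d) G = 0" by (simp add: wedge_def)
    then show "contraction V x (wedge x ?d) G = (\<Sum>v\<in>V. (x v)\<^sup>2) * ?d G"
      using koszul_identity[OF V G, of x ?d] by simp
  qed
  also have "\<dots> = (\<Sum>v\<in>V. (x v)\<^sup>2) * K F F'"
    by (simp add: K_def sum_distrib_left mult_ac)
  finally show ?thesis .
qed

section \<open>Incidence counts between vertices and faces\<close>

lemma prod_prod_incidence:
  assumes "finite V" "finite S" "\<And>A. A \<in> S \<Longrightarrow> A \<subseteq> V"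
  shows "(\<Prod>A\<in>S. \<Prod>i\<in>A. y i) = (\<Prod>i\<in>V. (y i :: 'a :: comm_semiring_1) ^ card {A \<in> S. i \<in> A})"
proof -
  have "(\<Prod>A\<in>S. \<Prod>i\<in>A. y i) = (\<Prod>A\<in>S. \<Prod>i\<in>V. if i \<in> A then y i else 1)"
    by (rule prod.cong[OF refl]) (simp add: assms(3) Int_absorb1 flip: prod.inter_restrict[OF assms(1)])
  also have "\<dots> = (\<Prod>i\<in>V. \<Prod>A\<in>S. if i \<in> A then y i else 1)" by (rule prod.swap)
  also have "\<dots> = (\<Prod>i\<in>V. y i ^ card {A \<in> S. i \<in> A})"
    by (intro prod.cong refl) (simp add: assms(2) flip: prod.inter_filter)
  finally show ?thesis .
qed

lemma sum_sum_incidence: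
  assumes "finite V" "finite S" "\<And>A. A \<in> S \<Longrightarrow> A \<subseteq> V"
  shows "(\<Sum>A\<in>S. \<Sum>i\<in>A. y i) = (\<Sum>i\<in>V. of_nat (card {A \<in> S. i \<in> A}) * (y i :: 'a :: comm_semiring_1))"
proof -
  have "(\<Sum>A\<in>S. \<Sum>i\<in>A. y i) = (\<Sum>A\<in>S. \<Sum>i\<in>V. if i \<in> A then y i else 0)"
    by (rule sum.cong[OF refl]) (simp add: assms(3) Int_absorb1 flip: sum.inter_restrict[OF assms(1)])
  also have "\<dots> = (\<Sum>i\<in>V. \<Sum>A\<in>S. if i \<in> A then y i else 0)" by (rule sum.swap)
  also have "\<dots> = (\<Sum>i\<in>V. of_nat (card {A \<in> S. i \<in> A}) * y i)"
    by (intro sum.cong refl) (simp add: assms(2) flip: sum.inter_filter)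
  finally show ?thesis .
qed

lemma card_subsets_of_size_containing:
  assumes V: "finite V" and i: "i \<in> V"
  shows "card {A \<in> subsets_of_size V (Suc j). i \<in> A} = (card V - 1) choose j"
proof -
  have "bij_betw (insert i) (subsets_of_size (V - {i}) j) {A \<in> subsets_of_size V (Suc j). i \<in> A}"
  proof (rule bij_betw_byWitness[of _ "\<lambda>A. A - {i}"])
    show "insert i ` subsets_of_size (V - {i}) j \<subseteq> {A \<in> subsets_of_size V (Suc j). i \<in> A}"
    proof safe
      fix B assume B: "B \<in> subsets_of_size (V - {i}) j"
      then have "finite B" "i \<notin> B" using V finite_subset by (auto simp: subsets_of_size_def)
      then show "insert i B \<in> subsets_of_size V (Suc j)"
        using B i by (auto simp: subsets_of_size_def)
    qed
    show "(\<lambda>A. A - {i}) ` {A \<in> subsets_of_size V (Suc j). i \<in> A} \<subseteq> subsets_of_size (V - {i}) j"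
      by (auto simp: subsets_of_size_def)
  qed (auto simp: subsets_of_size_def)
  then show ?thesis
    using card_subsets_of_size[of "V - {i}" j] V i bij_betw_same_card by fastforce
qed

lemma bd_sign_least:
  assumes "\<And>u. u \<in> B \<Longrightarrow> v \<le> u"
  shows "bd_sign v B = 1"
proof -
  have "{u \<in> B. u < v} = {}" using assms by fastforce
  then show ?thesis unfolding bd_sign_def by (simp only: card.empty power_0)
qed

lemma of_int_weighted_bd: "of_int (weighted_bd V (\<lambda>_. 1) B A) = weighted_bd V (\<lambda>_. 1) B A"
  unfolding weighted_bd_def contraction_def of_int_sum by (intro sum.cong refl) simp

text \<open>The Gram determinant of the columns in \<open>T\<close> is computed exactly, as the
  left-hand side, and then bounded by Hadamard's inequality. The bijections share the index range,
  so the submatrix of rows avoiding vertex 1 is square.\<close>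

lemma weighted_boundary_det_bound:
  fixes x :: "nat \<Rightarrow> real"
  assumes k: "1 \<le> k" "k < n" and x: "\<And>i. i \<in> {1..n} \<Longrightarrow> x i \<noteq> 0"
    and f: "bij_betw f {..<m} (subsets_of_size {2..n} k)"
    and g: "bij_betw g {..<m} T" and T: "T \<subseteq> subsets_of_size {1..n} (k + 1)"
  shows "(det (mat m m (\<lambda>(i, j). weighted_bd {1..n} x (f i) (g j))))\<^sup>2
      * ((\<Sum>i\<in>{1..n}. (x i)\<^sup>2) / (x 1)\<^sup>2) ^ ((n - 2) choose (k - 1))
    \<le> (\<Prod>\<tau>\<in>T. \<Sum>i\<in>\<tau>. (x i)\<^sup>2)"
proof -
  obtain j where kj: "k = Suc j" using k by (cases k) auto
  define U V where "U = {1..n}" and "V = {2..n}"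
  define S R where "S = subsets_of_size V k" and "R = subsets_of_size V j"
  have fin: "finite U" "finite V" "finite S" "finite R"
    by (simp_all add: U_def V_def S_def R_def finite_subsets_of_size)
  have U: "U = insert 1 V" "1 \<notin> V" using k by (auto simp: U_def V_def)
  have x1: "x 1 \<noteq> 0" using x k by auto
  define a where "a = (\<Sum>v\<in>V. (x v)\<^sup>2)"
  have a: "a > 0"
    unfolding a_def using k x by (intro sum_pos2[of _ 2]) (auto simp: V_def)
  \<comment> \<open>Solving for a row through vertex 1 divides by \<open>x 1\<close>, so a product
    of two entries from such a row carries the factor \<open>c\<close>.\<close>
  define c where "c = 1 / (x 1)\<^sup>2"
  have s: "(\<Sum>i\<in>{1..n}. (x i)\<^sup>2) / (x 1)\<^sup>2 = 1 + c * a"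
    using U fin x1 unfolding U_def[symmetric] by (simp add: a_def c_def add_divide_distrib)
  define w where "w A i = weighted_bd U x A (g i)" for A i
  define L where "L F F' = (\<Sum>G\<in>R. weighted_bd V x G F * weighted_bd V x G F')" for F F'
  define K where "K = mat m m (\<lambda>(i, l). L (f i) (f l))"
  define W where "W = mat m m (\<lambda>(i, l). w (f i) l)"
  have carr: "K \<in> carrier_mat m m" "W \<in> carrier_mat m m" by (auto simp: K_def W_def)
  have fS: "bij_betw f {..<m} S" using f by (simp add: S_def V_def)
  have fi: "f i \<in> S" if "i < m" for i using fS that by (auto simp: bij_betw_def)
  have gT: "g i \<in> subsets_of_size U (Suc k)" if "i < m" for i
    using g T that by (auto simp: bij_betw_def U_def)
  note reindex = sum.reindex_bij_betw[OF fS]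

  \<comment> \<open>Every column is a cycle for the weighted boundary. Its contraction at
    \<open>G\<close> vanishes, and the summand of vertex 1, whose sign is 1 because 1 is least, can
    be solved for.\<close>
  have cone: "w (insert 1 G) p * x 1 = - (\<Sum>F\<in>S. weighted_bd V x G F * w F p)" if G: "G \<in> R" for G p
  proof -
    have GV: "G \<subseteq> V" using G by (auto simp: R_def subsets_of_size_def)
    have sgn: "bd_sign 1 G = 1" using GV by (intro bd_sign_least) (auto simp: V_def)
    have "contraction U x (\<lambda>A. w A p) G = 0"
      unfolding w_def weighted_bd_def by (rule contraction_contraction) (use fin GV U in auto)
    moreover have "U - G = insert 1 (V - G)" using U GV by auto
    moreover have "1 \<notin> V - G" "finite (V - G)" using U fin by auto
    ultimately have "x 1 * w (insert 1 G) p + contraction V x (\<lambda>A. w A p) G = 0"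
      by (simp add: contraction_def sgn[simplified])
    moreover have "contraction V x (\<lambda>A. w A p) G = (\<Sum>F\<in>S. weighted_bd V x G F * w F p)"
      unfolding S_def kj using contraction_eq_sum_weighted_bd[OF fin(2) G[unfolded R_def]] .
    ultimately show ?thesis by (simp add: mult.commute)
  qed
  have cone2: "w (insert 1 G) p * w (insert 1 G) q =
      c * ((\<Sum>F\<in>S. weighted_bd V x G F * w F p) * (\<Sum>F\<in>S. weighted_bd V x G F * w F q))" if "G \<in> R" for G p q
  proof -
    have "w (insert 1 G) p * w (insert 1 G) q =
        c * ((w (insert 1 G) p * x 1) * (w (insert 1 G) q * x 1))"
      using x1 by (simp add: c_def power2_eq_square)
    then show ?thesis unfolding cone[OF that] by simp
  qed
  have split: "subsets_of_size U k = S \<union> insert 1 ` R"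
  proof (intro equalityI subsetI)
    fix A assume A: "A \<in> subsets_of_size U k"
    show "A \<in> S \<union> insert 1 ` R"
    proof (cases "1 \<in> A")
      case True
      then have "A - {1} \<in> R" "A = insert 1 (A - {1})"
        using A U by (auto simp: R_def subsets_of_size_def kj)
      then show ?thesis by blast
    qed (use A U in \<open>auto simp: S_def subsets_of_size_def\<close>)
  next
    fix A assume "A \<in> S \<union> insert 1 ` R"
    moreover have "card (insert 1 G) = k" "insert 1 G \<subseteq> U" if "G \<in> R" for G
    proof -
      have "finite G" "1 \<notin> G" using that fin U finite_subset by (auto simp: R_def subsets_of_size_def)
      then show "card (insert 1 G) = k" using that by (simp add: R_def subsets_of_size_def kj)
      show "insert 1 G \<subseteq> U" using that U by (auto simp: R_def subsets_of_size_def)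
    qed
    ultimately show "A \<in> subsets_of_size U k" using U by (auto simp: S_def subsets_of_size_def)
  qed
  \<comment> \<open>Rows through vertex 1 are eliminated with \<open>cone2\<close>; their
    contribution becomes the bilinear form \<open>L\<close> on the rows avoiding 1.\<close>
  have gram: "(\<Sum>A\<in>subsets_of_size U k. w A p * w A q) =
      (\<Sum>F\<in>S. w F p * (w F q + c * (\<Sum>F'\<in>S. L F F' * w F' q)))" for p q
  proof -
    have disj: "S \<inter> insert 1 ` R = {}" using U by (auto simp: S_def subsets_of_size_def)
    have inj: "inj_on (insert 1) R"
      using U by (auto simp: inj_on_def R_def subsets_of_size_def) (metis insert_ident subset_iff)+
    have "(\<Sum>A\<in>subsets_of_size U k. w A p * w A q) =
        (\<Sum>F\<in>S. w F p * w F q) + (\<Sum>G\<in>R. w (insert 1 G) p * w (insert 1 G) q)"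
      unfolding split sum.union_disjoint[OF fin(3) finite_imageI[OF fin(4)] disj] sum.reindex[OF inj]
      by simp
    also have "(\<Sum>G\<in>R. w (insert 1 G) p * w (insert 1 G) q) =
        (\<Sum>G\<in>R. \<Sum>F\<in>S. \<Sum>F'\<in>S. c * w F p * (weighted_bd V x G F * weighted_bd V x G F') * w F' q)"
      by (rule sum.cong[OF refl], simp only: cone2, subst sum_product, simp only: sum_distrib_left)
        (simp only: mult_ac)
    also have "\<dots> = (\<Sum>F\<in>S. \<Sum>G\<in>R. \<Sum>F'\<in>S. c * w F p * (weighted_bd V x G F * weighted_bd V x G F') * w F' q)"
      by (rule sum.swap)
    also have "\<dots> = (\<Sum>F\<in>S. \<Sum>F'\<in>S. \<Sum>G\<in>R. c * w F p * (weighted_bd V x G F * weighted_bd V x G F') * w F' q)"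
      by (rule sum.cong[OF refl], rule sum.swap)
    also have "\<dots> = (\<Sum>F\<in>S. w F p * (c * (\<Sum>F'\<in>S. L F F' * w F' q)))"
      by (simp add: L_def sum_distrib_left sum_distrib_right mult_ac)
    finally show ?thesis by (simp add: distrib_left sum.distrib)
  qed
  define Gm where "Gm = mat m m (\<lambda>(p, q). \<Sum>A\<in>subsets_of_size U k. w A p * w A q)"
  have "Gm = transpose_mat W * ((1\<^sub>m m + c \<cdot>\<^sub>m K) * W)"
  proof (rule eq_matI)
    fix p q assume "p < dim_row (transpose_mat W * ((1\<^sub>m m + c \<cdot>\<^sub>m K) * W))"
      "q < dim_col (transpose_mat W * ((1\<^sub>m m + c \<cdot>\<^sub>m K) * W))"
    then have pq: "p < m" "q < m" by (auto simp: W_def)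
    have inner: "((1\<^sub>m m + c \<cdot>\<^sub>m K) * W) $$ (i, q) = w (f i) q + c * (\<Sum>F'\<in>S. L (f i) F' * w F' q)"
      if "i < m" for i
    proof -
      have "((1\<^sub>m m + c \<cdot>\<^sub>m K) * W) $$ (i, q) =
          (\<Sum>l<m. ((if i = l then 1 else 0) + c * L (f i) (f l)) * w (f l) q)"
        using that pq by (simp add: K_def W_def scalar_prod_def lessThan_atLeast0)
          (intro sum.cong refl, auto)
      also have "\<dots> = (\<Sum>l<m. if i = l then w (f l) q else 0) + c * (\<Sum>l<m. L (f i) (f l) * w (f l) q)"
        unfolding sum_distrib_left sum.distrib[symmetric]
        by (intro sum.cong refl) (auto simp: distrib_right)
      also have "\<dots> = w (f i) q + c * (\<Sum>F'\<in>S. L (f i) F' * w F' q)"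
        using that by (simp add: reindex[of "\<lambda>F'. L (f i) F' * w F' q"])
      finally show ?thesis .
    qed
    have "(transpose_mat W * ((1\<^sub>m m + c \<cdot>\<^sub>m K) * W)) $$ (p, q) =
        (\<Sum>i<m. w (f i) p * ((1\<^sub>m m + c \<cdot>\<^sub>m K) * W) $$ (i, q))"
      using pq carr by (simp add: scalar_prod_def lessThan_atLeast0 W_def del: index_mult_mat)
        (simp add: index_mult_mat(1) scalar_prod_def)
    also have "\<dots> = (\<Sum>i<m. w (f i) p * (w (f i) q + c * (\<Sum>F'\<in>S. L (f i) F' * w F' q)))"
      by (intro sum.cong refl) (simp only: inner lessThan_iff)
    also have "\<dots> = Gm $$ (p, q)"
      using pq unfolding reindex[of "\<lambda>F. w F p * (w F q + c * (\<Sum>F'\<in>S. L F F' * w F' q))"]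
      by (simp add: Gm_def gram)
    finally show "Gm $$ (p, q) = (transpose_mat W * ((1\<^sub>m m + c \<cdot>\<^sub>m K) * W)) $$ (p, q)" by simp
  qed (auto simp: Gm_def W_def)
  moreover have D: "1\<^sub>m m + c \<cdot>\<^sub>m K \<in> carrier_mat m m" using carr by simp
  ultimately have "det Gm = det W * (det (1\<^sub>m m + c \<cdot>\<^sub>m K) * det W)"
    using det_mult[OF transpose_carrier_mat[THEN iffD2, OF carr(2)] mult_carrier_mat[OF D carr(2)]]
      det_mult[OF D carr(2)] det_transpose[OF carr(2)] by metis
  moreover have "det (1\<^sub>m m + c \<cdot>\<^sub>m K) = (1 + c * a) ^ ((n - 2) choose j)"
  proof (rule det_one_plus_quasi_idempotent[OF carr(1)])
    show "K * K = a \<cdot>\<^sub>m K"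
    proof (rule eq_matI)
      fix p q assume "p < dim_row (a \<cdot>\<^sub>m K)" "q < dim_col (a \<cdot>\<^sub>m K)"
      then have pq: "p < m" "q < m" by (auto simp: K_def)
      have "(K * K) $$ (p, q) = (\<Sum>l<m. L (f p) (f l) * L (f l) (f q))"
        using pq by (simp add: K_def scalar_prod_def lessThan_atLeast0)
      also have "\<dots> = (\<Sum>H\<in>S. L (f p) H * L H (f q))"
        by (rule reindex[of "\<lambda>H. L (f p) H * L H (f q)"])
      also have "\<dots> = a * L (f p) (f q)"
        unfolding L_def R_def S_def a_def kj
        by (rule weighted_bd_laplacian_square[OF fin(2)]) (use fi pq in \<open>auto simp: S_def kj\<close>)
      finally show "(K * K) $$ (p, q) = (a \<cdot>\<^sub>m K) $$ (p, q)" using pq by (simp add: K_def)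
    qed (auto simp: K_def)
    have "(\<Sum>i<m. K $$ (i, i)) = (\<Sum>F\<in>S. L F F)"
      using reindex[of "\<lambda>F. L F F"] by (simp add: K_def)
    also have "\<dots> = (\<Sum>F\<in>S. \<Sum>v\<in>F. (x v)\<^sup>2)"
    proof (rule sum.cong[OF refl])
      fix F assume "F \<in> S"
      then show "L F F = (\<Sum>v\<in>F. (x v)\<^sup>2)"
        unfolding L_def R_def S_def kj
        using sum_weighted_bd_squares[OF fin(2), of F j x] by (simp add: power2_eq_square)
    qed
    also have "\<dots> = (\<Sum>v\<in>V. of_nat (card {F \<in> S. v \<in> F}) * (x v)\<^sup>2)"
      by (rule sum_sum_incidence) (auto simp: fin, auto simp: S_def subsets_of_size_def)
    \<comment> \<open>Every vertex of \<open>V\<close> lies in equally many sets of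
      \<open>S\<close>, so the trace is a multiple of \<open>a\<close>, and the multiplier is the
      rank.\<close>
    also have "\<dots> = (\<Sum>v\<in>V. of_nat ((n - 2) choose j) * (x v)\<^sup>2)"
    proof (rule sum.cong[OF refl])
      fix v assume "v \<in> V"
      moreover have "card V - 1 = n - 2" by (simp add: V_def)
      ultimately show "of_nat (card {F \<in> S. v \<in> F}) * (x v)\<^sup>2 = of_nat ((n - 2) choose j) * (x v)\<^sup>2"
        unfolding S_def kj using card_subsets_of_size_containing[OF fin(2), of v j] by simp
    qed
    also have "\<dots> = a * real ((n - 2) choose j)"
      by (simp add: a_def sum_distrib_left mult.commute)
    finally show "(\<Sum>i<m. K $$ (i, i)) = a * real ((n - 2) choose j)" .
  qed (use a in simp)
  ultimately have "(det W)\<^sup>2 * (1 + c * a) ^ ((n - 2) choose j) = det Gm"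
    by (simp add: power2_eq_square mult_ac)
  also have "\<dots> \<le> (\<Prod>i<m. \<Sum>A\<in>subsets_of_size U k. (w A i)\<^sup>2)"
    unfolding Gm_def
  proof (rule hadamard_gram)
    fix i assume i: "i < m"
    have gi: "g i \<subseteq> U" "card (g i) = Suc k" using gT[OF i] by (auto simp: subsets_of_size_def)
    then obtain v where v: "v \<in> g i" by fastforce
    have "(\<Sum>v\<in>g i. (x v)\<^sup>2) > 0"
      using v gi fin x finite_subset by (intro sum_pos2[of _ v]) (auto simp: U_def)
    then show "(\<Sum>A\<in>subsets_of_size U k. (w A i)\<^sup>2) > 0"
      unfolding w_def by (simp add: sum_weighted_bd_squares[OF fin(1) gT[OF i]])
  qed
  also have "\<dots> = (\<Prod>i<m. \<Sum>v\<in>g i. (x v)\<^sup>2)"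
    unfolding w_def by (rule prod.cong[OF refl]) (simp add: sum_weighted_bd_squares[OF fin(1) gT])
  also have "\<dots> = (\<Prod>\<tau>\<in>T. \<Sum>i\<in>\<tau>. (x i)\<^sup>2)"
    by (rule prod.reindex_bij_betw[OF g])
  finally show ?thesis
    unfolding s W_def w_def U_def kj by simp
qed

subsection \<open>Homology as a lattice quotient\<close>

lemma bd_eq_contraction: "B \<subseteq> {1..n} \<Longrightarrow> bd n c B = contraction {1..n} (\<lambda>_. 1) c B"
  by (simp add: bd_def contraction_def)

lemma bd_diff: "bd n (a - b) = bd n a - bd n b"
  by (simp add: bd_def fun_eq_iff sum_subtractf right_diff_distrib)

lemma bd_bd: "bd n (bd n c) = (\<lambda>_. 0)"
proof
  fix B
  show "bd n (bd n c) B = 0"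
  proof (cases "B \<subseteq> {1..n}")
    case True
    then have "bd n (bd n c) B = contraction {1..n} (\<lambda>_. 1) (contraction {1..n} (\<lambda>_. 1) c) B"
      unfolding bd_eq_contraction[OF True] contraction_def[of _ _ "bd n c"] contraction_def[of _ _ "contraction _ _ _"]
      by (intro sum.cong refl) (simp add: bd_eq_contraction)
    then show ?thesis by (simp only: contraction_contraction[OF finite_atLeastAtMost True])
  qed (simp add: bd_def)
qed

lemma bd_in_cycles:
  assumes "T \<subseteq> faces_of_size n (k + 1)" "c \<in> chains_on T"
  shows "bd n c \<in> cycles_km1 n k"
proof -
  have "B \<in> faces_of_size n k" if B: "bd n c B \<noteq> 0" for B
  proof -
    have BU: "B \<subseteq> {1..n}" using B by (auto simp: bd_def split: if_splits)
    have "(\<Sum>v\<in>{1..n} - B. bd_sign v B * c (insert v B)) \<noteq> 0"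
      using B BU by (simp add: bd_def)
    then obtain v where v: "v \<in> {1..n} - B" "c (insert v B) \<noteq> 0"
      by (metis (no_types, lifting) mult_zero_right sum.neutral)
    have "insert v B \<in> faces_of_size n (k + 1)"
      using v(2) assms by (auto simp: chains_on_def)
    moreover have "finite B" using BU finite_subset by blast
    ultimately show ?thesis using v(1) BU by (simp add: faces_of_size_def)
  qed
  then show ?thesis by (auto simp: cycles_km1_def chains_on_def bd_bd)
qed

text \<open>The boundary coefficient at \<open>G\<close> involves only the face
  \<open>insert 1 G\<close> and faces avoiding 1. Hence restriction to the faces avoiding 1 is
  injective on cycles.\<close>

lemma cycle_eq_0:
  assumes k: "1 \<le> k" "k < n" and c: "c \<in> cycles_km1 n k"
    and zero: "\<And>F. F \<in> subsets_of_size {2..n} k \<Longrightarrow> c F = 0"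
  shows "c = (\<lambda>_. 0)"
proof
  fix B
  show "c B = 0"
  proof (cases "B \<in> faces_of_size n k \<and> 1 \<in> B")
    case True
    define G where "G = B - {1}"
    have B: "B = insert 1 G" "1 \<notin> G" "G \<subseteq> {2..n}" "G \<subseteq> {1..n}" "card B = k" "finite G"
      using True finite_subset[of B "{1..n}"] by (auto simp: G_def faces_of_size_def)
    have sgn: "bd_sign 1 G = 1" using B(3) by (intro bd_sign_least) auto
    have "insert v G \<in> subsets_of_size {2..n} k" if "v \<in> {2..n} - G" for v
      using that B by (auto simp: subsets_of_size_def)
    then have z: "c (insert v G) = 0" if "v \<in> {2..n} - G" for v using zero that by blast
    have e: "{1..n} - G = insert 1 ({2..n} - G)" using B(2) k by auto
    have "bd n c G = c B"
      using B(4) z unfolding bd_def e by (simp add: sgn[simplified] B(1))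
    moreover have "bd n c G = 0" using c by (simp add: cycles_km1_def)
    ultimately show ?thesis by simp
  next
    case False
    show ?thesis
    proof (rule ccontr)
      assume "c B \<noteq> 0"
      then have "B \<in> faces_of_size n k" using c by (auto simp: cycles_km1_def chains_on_def)
      moreover from this False have "1 \<notin> B" by blast
      moreover have "{2..n} = {1..n} - {1}" by auto
      ultimately have "B \<in> subsets_of_size {2..n} k"
        unfolding faces_of_size_def subsets_of_size_def \<open>{2..n} = {1..n} - {1}\<close> by blast
      then show False using zero \<open>c B \<noteq> 0\<close> by blast
    qed
  qed
qed

text \<open>Restriction to the faces avoiding 1 embeds the cycles into integer vectors and maps the
  boundaries onto the column lattice of the matrix, so distinct homology classes receive distinct
  representatives in a lattice transversal.\<close>

lemma homology_order_le_det:
  assumes k: "1 \<le> k" "k < n" and T: "T \<subseteq> faces_of_size n (k + 1)" and H0: "Hk_zero n T"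
    and f: "bij_betw f {..<m} (subsets_of_size {2..n} k)" and g: "bij_betw g {..<m} T"
  shows "int (homology_order n k T) \<le>
    \<bar>det (mat m m (\<lambda>(i, j). weighted_bd {1..n} (\<lambda>_. 1 :: int) (f i) (g j)))\<bar>"
proof -
  define A where "A i j = weighted_bd {1..n} (\<lambda>_. 1 :: int) (f i) (g j)" for i j
  define Z where "Z = cycles_km1 n k"
  define ch where "ch z C = (\<Sum>j<m. if C = g j then z j else 0)" for z :: "nat \<Rightarrow> int" and C
  have gT: "g j \<in> T" if "j < m" for j using g that by (auto simp: bij_betw_def)
  have ch_T: "ch z \<in> chains_on T" for z
  proof -
    have "C \<in> T" if "ch z C \<noteq> 0" for C
    proof (rule ccontr)
      assume "C \<notin> T"
      then have "ch z C = 0" unfolding ch_def using gT by (intro sum.neutral) auto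
      then show False using that by simp
    qed
    then show ?thesis by (auto simp: chains_on_def)
  qed
  have f_S: "f i \<in> subsets_of_size {2..n} k" if "i < m" for i
    using bij_betw_apply[OF f, of i] that by simp
  have f_sub: "f i \<subseteq> {1..n}" if "i < m" for i
    using f_S[OF that] by (auto simp: subsets_of_size_def)
  have bd_ch: "bd n (ch z) (f i) = (\<Sum>j<m. A i j * z j)" if "i < m" for z i
  proof -
    have "bd n (ch z) (f i) = (\<Sum>v\<in>{1..n} - f i. \<Sum>j<m.
        bd_sign v (f i) * (if insert v (f i) = g j then 1 else 0) * z j)"
      unfolding bd_def ch_def if_P[OF f_sub[OF that]] sum_distrib_left
      by (intro sum.cong refl) simp
    also have "\<dots> = (\<Sum>j<m. A i j * z j)"
      unfolding A_def weighted_bd_def contraction_def sum_distrib_right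
      by (subst sum.swap) (simp add: mult_ac)
    finally show ?thesis .
  qed
  have surj: "\<exists>i<m. F = f i" if "F \<in> subsets_of_size {2..n} k" for F
    using f that by (auto simp: bij_betw_def image_iff)
  have Z_diff: "a - b \<in> Z" if "a \<in> Z" "b \<in> Z" for a b
    using that by (auto simp: Z_def cycles_km1_def chains_on_def bd_diff fun_eq_iff) metis
  have ch_Z: "bd n (ch z) \<in> Z" for z unfolding Z_def using bd_in_cycles[OF T ch_T] .
  \<comment> \<open>A kernel vector would give a chain on \<open>T\<close> whose boundary vanishes
    on all faces avoiding 1, hence everywhere; \<open>Hk_zero\<close> forces this chain to be
    0.\<close>
  have "det (mat m m (\<lambda>(i, j). A i j)) \<noteq> 0"
  proof
    assume "det (mat m m (\<lambda>(i, j). A i j)) = 0"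
    then obtain v where v: "v \<in> carrier_vec m" "v \<noteq> 0\<^sub>v m" "mat m m (\<lambda>(i, j). A i j) *\<^sub>v v = 0\<^sub>v m"
      using det_0_iff_vec_prod_zero[of "mat m m (\<lambda>(i, j). A i j)" m] by auto
    have "(\<Sum>j<m. A i j * v $ j) = 0" if "i < m" for i
    proof -
      have "(mat m m (\<lambda>(i, j). A i j) *\<^sub>v v) $ i = (\<Sum>j<m. A i j * v $ j)"
        using that v(1) by (simp add: scalar_prod_def lessThan_atLeast0)
      then show ?thesis using v(3) that by simp
    qed
    then have "bd n (ch (\<lambda>j. v $ j)) (f i) = 0" if "i < m" for i using that by (simp add: bd_ch)
    then have "bd n (ch (\<lambda>j. v $ j)) = (\<lambda>_. 0)"
      using surj by (intro cycle_eq_0[OF k ch_Z[unfolded Z_def]]) blast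
    then have ch0: "ch (\<lambda>j. v $ j) = (\<lambda>_. 0)" using H0 ch_T unfolding Hk_zero_def by blast
    have "v $ i = 0" if "i < m" for i
    proof -
      have "ch (\<lambda>j. v $ j) (g i) = (\<Sum>j<m. if j = i then v $ j else 0)"
        unfolding ch_def using g that by (intro sum.cong refl) (auto simp: bij_betw_def inj_on_def)
      then show ?thesis using that ch0 by (simp add: fun_eq_iff)
    qed
    then show False using v(1,2) by (auto intro: eq_vecI)
  qed
  from lattice_transversal[OF this] obtain R
    where R: "finite R" "int (card R) \<le> \<bar>det (mat m m (\<lambda>(i, j). A i j))\<bar>"
      "\<And>v. \<exists>r\<in>R. \<exists>z. \<forall>j<m. v j - r j = (\<Sum>l<m. A j l * z l)"
    by blast
  define rel where "rel = {(a, b). a \<in> Z \<and> b \<in> Z \<and> a - b \<in> boundaries_km1 n T}"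
  have "\<exists>r\<in>R. \<exists>z. \<forall>j<m. c (f j) - r j = (\<Sum>l<m. A j l * z l)" for c
    using R(3)[of "\<lambda>j. c (f j)"] .
  \<comment> \<open>\<open>\<phi> c\<close> is the transversal representative of the restriction of
    \<open>c\<close>, and \<open>\<zeta> c\<close> holds the lattice coordinates of the
    difference.\<close>
  then obtain \<phi> \<zeta> where \<phi>: "\<And>c. \<phi> c \<in> R"
    "\<And>c j. j < m \<Longrightarrow> c (f j) - \<phi> c j = (\<Sum>l<m. A j l * \<zeta> c l)" by metis
  have same: "a - b \<in> boundaries_km1 n T" if ab: "a \<in> Z" "b \<in> Z" "\<phi> a = \<phi> b" for a b
  proof -
    \<comment> \<open>With a common representative, \<open>a - b\<close> restricts to the lattice
      vector with these coordinates, which is also the restriction of the boundary of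
      \<open>ch z\<close>; cycles that agree there are equal.\<close>
    define z where "z l = \<zeta> a l - \<zeta> b l" for l
    have "a (f i) - b (f i) = (\<Sum>l<m. A i l * z l)" if i: "i < m" for i
      using \<phi>(2)[OF i, of a] \<phi>(2)[OF i, of b] ab(3)
      by (simp add: z_def right_diff_distrib sum_subtractf)
    then have "(a - b - bd n (ch z)) (f i) = 0" if "i < m" for i using that by (simp add: bd_ch)
    then have "a - b - bd n (ch z) = (\<lambda>_. 0)"
      using surj Z_diff[OF Z_diff[OF ab(1,2)] ch_Z] unfolding Z_def
      by (intro cycle_eq_0[OF k]) blast+
    then have "a - b = bd n (ch z)" by (simp add: fun_eq_iff)
    then show ?thesis using ch_T by (auto simp: boundaries_km1_def)
  qed
  have bdry_diff: "a - b \<in> boundaries_km1 n T"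
    if bdry: "a \<in> boundaries_km1 n T" "b \<in> boundaries_km1 n T" for a b
  proof -
    obtain a' b' where ab: "a' \<in> chains_on T" "b' \<in> chains_on T" "a = bd n a'" "b = bd n b'"
      using bdry by (auto simp: boundaries_km1_def)
    then have "a' - b' \<in> chains_on T" by (auto simp: chains_on_def) metis
    moreover have "a - b = bd n (a' - b')" by (simp add: ab bd_diff)
    ultimately show ?thesis by (auto simp: boundaries_km1_def)
  qed
  have class_eq: "rel `` {a} = rel `` {b}" if ab: "a \<in> Z" "b \<in> Z" "\<phi> a = \<phi> b" for a b
  proof -
    have "a - c - (a - b) = b - c" "b - c - (b - a) = a - c" for c by (simp_all add: fun_eq_iff)
    then have "a - c \<in> boundaries_km1 n T \<longleftrightarrow> b - c \<in> boundaries_km1 n T" for c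
      using bdry_diff[of "a - c" "a - b"] bdry_diff[of "b - c" "b - a"]
        same[OF ab] same[OF ab(2,1) ab(3)[symmetric]] by metis
    then show ?thesis using ab by (auto simp: rel_def)
  qed
  \<comment> \<open>Any cycle represented by \<open>r\<close> will do, since \<open>class_eq\<close>
    makes its class independent of the choice. If there is none the value is arbitrary, which is
    harmless for covering the quotient.\<close>
  define \<psi> where "\<psi> r = rel `` {SOME c. c \<in> Z \<and> \<phi> c = r}" for r
  have "Z // rel \<subseteq> \<psi> ` R"
  proof
    fix X assume "X \<in> Z // rel"
    then obtain c where c: "c \<in> Z" "X = rel `` {c}" by (auto simp: quotient_def)
    have "(SOME c'. c' \<in> Z \<and> \<phi> c' = \<phi> c) \<in> Z \<and> \<phi> (SOME c'. c' \<in> Z \<and> \<phi> c' = \<phi> c) = \<phi> c"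
      by (rule someI[of _ c]) (use c in simp)
    then have "\<psi> (\<phi> c) = X" unfolding \<psi>_def c(2) using c(1) by (intro class_eq) auto
    then show "X \<in> \<psi> ` R" using \<phi>(1) by blast
  qed
  then have "card (Z // rel) \<le> card R" by (rule surj_card_le[OF R(1)])
  then show ?thesis using R(2) unfolding homology_order_def Z_def rel_def A_def by simp
qed

subsection \<open>The degree bound\<close>

theorem theorem2:
  fixes n k :: nat and T :: "nat set set"
  assumes "1 \<le> k" and "k < n" and "Q_acyclic n k T"
  shows "(\<forall>x :: nat \<Rightarrow> real. (\<forall>i\<in>{1..n}. x i \<noteq> 0) \<longrightarrow>
            real (homology_order n k T) ^ 2 \<le> bound_rhs n k T x)
       \<and> real (homology_order n k T) ^ 2
           \<le> Inf {bound_rhs n k T x | x :: nat \<Rightarrow> real. \<forall>i\<in>{1..n}. x i \<noteq> 0}"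
proof -
  define m where "m = (n - 1) choose k"
  define S where "S = subsets_of_size {2..n} k"
  have T: "T \<subseteq> faces_of_size n (k + 1)" "card T = m" "Hk_zero n T"
    using assms(3) by (auto simp: Q_acyclic_def m_def)
  have T': "T \<subseteq> subsets_of_size {1..n} (k + 1)"
    using T(1) by (simp add: faces_of_size_def subsets_of_size_def)
  have finT: "finite T" using T' finite_subset finite_subsets_of_size by blast
  have finS: "finite S" "card S = m"
    by (simp_all add: S_def m_def finite_subsets_of_size card_subsets_of_size)
  obtain f where f: "bij_betw f {..<m} S"
    using ex_bij_betw_nat_finite[OF finS(1)] finS(2) by (auto simp: lessThan_atLeast0)
  obtain g where g: "bij_betw g {..<m} T"
    using ex_bij_betw_nat_finite[OF finT] T(2) by (auto simp: lessThan_atLeast0)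
  define M where "M = mat m m (\<lambda>(i, j). weighted_bd {1..n} (\<lambda>_. 1 :: int) (f i) (g j))"
  have order: "int (homology_order n k T) \<le> \<bar>det M\<bar>"
    unfolding M_def by (rule homology_order_le_det[OF assms(1,2) T(1,3) f[unfolded S_def] g])
  have bound: "real (homology_order n k T) ^ 2 \<le> bound_rhs n k T x"
    if x: "\<forall>i\<in>{1..n}. x i \<noteq> 0" for x :: "nat \<Rightarrow> real"
  proof -
    define m1 where "m1 = (n - 2) choose (k - 1)"
    define W where "W = mat m m (\<lambda>(i, j). weighted_bd {1..n} x (f i) (g j))"
    define s where "s = (\<Sum>i\<in>{1..n}. (x i)\<^sup>2)"
    define P where "P = (\<Prod>\<tau>\<in>T. \<Sum>i\<in>\<tau>. (x i)\<^sup>2)"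
    \<comment> \<open>\<open>PS\<close> and \<open>PT\<close> are the squared monomials of all row
      faces and all column faces: a vertex other than 1 lies in \<open>m1\<close> row faces, a
      vertex \<open>i\<close> in \<open>vdeg T i\<close> column faces.\<close>
    define PS where "PS = (\<Prod>i\<in>{2..n}. ((x i)\<^sup>2) ^ m1)"
    define PT where "PT = (\<Prod>i\<in>{1..n}. ((x i)\<^sup>2) ^ vdeg T i)"
    have x1: "x 1 \<noteq> 0" using x assms(2) by auto
    have s: "s > 0"
      unfolding s_def using assms(2) x1 by (intro sum_pos2[of _ 1]) auto
    have PT: "PT > 0" unfolding PT_def using x by (intro prod_pos) auto
    have n1: "{1..n} = insert 1 {2..n}" using assms(2) by auto
    have W_le: "(det W)\<^sup>2 * (s / (x 1)\<^sup>2) ^ m1 \<le> P"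
      unfolding W_def s_def P_def m1_def using x
      by (intro weighted_boundary_det_bound[OF assms(1,2) _ f[unfolded S_def] g T']) auto
    define XS XT where "XS = (\<Prod>F\<in>S. \<Prod>i\<in>F. x i)" and "XT = (\<Prod>\<tau>\<in>T. \<Prod>i\<in>\<tau>. x i)"
    have XS: "XS\<^sup>2 = PS"
    proof -
      have "XS\<^sup>2 = (\<Prod>F\<in>S. \<Prod>i\<in>F. (x i)\<^sup>2)" by (simp add: XS_def prod_power_distrib)
      also have "\<dots> = (\<Prod>i\<in>{2..n}. ((x i)\<^sup>2) ^ card {F \<in> S. i \<in> F})"
        by (rule prod_prod_incidence) (auto simp: finS, auto simp: S_def subsets_of_size_def)
      also have "\<dots> = PS"
        unfolding PS_def
      proof (rule prod.cong[OF refl])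
        fix i assume "i \<in> {2..n}"
        moreover have "card {2..n} - 1 = n - 2" by simp
        ultimately show "((x i)\<^sup>2) ^ card {F \<in> S. i \<in> F} = ((x i)\<^sup>2) ^ m1"
          unfolding S_def m1_def
          using card_subsets_of_size_containing[of "{2..n}" i "k - 1"] assms(1) by simp
      qed
      finally show ?thesis .
    qed
    have XT: "XT\<^sup>2 = PT"
    proof -
      have "XT\<^sup>2 = (\<Prod>F\<in>T. \<Prod>i\<in>F. (x i)\<^sup>2)" by (simp add: XT_def prod_power_distrib)
      also have "\<dots> = PT"
        unfolding PT_def vdeg_def
        by (rule prod_prod_incidence) (use finT T' in \<open>auto simp: subsets_of_size_def\<close>)
      finally show ?thesis .
    qed
    \<comment> \<open>Scaling the rows of \<open>W\<close> by their face monomials gives the integer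
      matrix with columns scaled by theirs; then determinants are compared.\<close>
    have detW: "XS * det W = real_of_int (det M) * XT"
    proof -
      have fi: "f i \<subseteq> {1..n}" if "i < m" for i
        using bij_betw_apply[OF f, of i] that by (auto simp: S_def subsets_of_size_def)
      have "mat m m (\<lambda>(i, j). (\<Prod>v\<in>f i. x v) * weighted_bd {1..n} x (f i) (g j) * 1) =
          mat m m (\<lambda>(i, j). 1 * weighted_bd {1..n} (\<lambda>_. 1) (f i) (g j) * (\<Prod>v\<in>g j. x v))"
        by (intro eq_matI) (simp_all add: weighted_bd_rescale fi del: One_nat_def)
      moreover have "map_mat of_int M = mat m m (\<lambda>(i, j). weighted_bd {1..n} (\<lambda>_. 1 :: real) (f i) (g j))"
        by (intro eq_matI) (auto simp: M_def of_int_weighted_bd)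
      moreover have "det (map_mat real_of_int M) = of_int (det M)" by (rule of_int_hom.hom_det)
      moreover have "(\<Prod>i<m. \<Prod>v\<in>f i. x v) = XS"
        unfolding XS_def by (rule prod.reindex_bij_betw[OF f])
      moreover have "(\<Prod>i<m. \<Prod>v\<in>g i. x v) = XT"
        unfolding XT_def by (rule prod.reindex_bij_betw[OF g])
      ultimately show ?thesis
        unfolding W_def using det_scale_rows_cols[of m "\<lambda>i. \<Prod>v\<in>f i. x v" "\<lambda>i j. weighted_bd {1..n} x (f i) (g j)" "\<lambda>_. 1"]
          det_scale_rows_cols[of m "\<lambda>_. 1" "\<lambda>i j. weighted_bd {1..n} (\<lambda>_. 1) (f i) (g j)" "\<lambda>j. \<Prod>v\<in>g j. x v"]
        by (simp add: mult.commute)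
    qed
    have "real (homology_order n k T) ^ 2 \<le> (real_of_int (det M))\<^sup>2"
    proof -
      have "real (homology_order n k T) \<le> \<bar>real_of_int (det M)\<bar>"
        using order by (metis of_int_abs of_int_le_iff of_int_of_nat_eq)
      then show ?thesis by (intro abs_le_square_iff[THEN iffD1]) simp
    qed
    also have "\<dots> = (det W)\<^sup>2 * PS / PT"
      using arg_cong[OF detW, of "\<lambda>y. y\<^sup>2"] PT by (simp add: power_mult_distrib XS XT field_simps)
    also have "\<dots> \<le> P * ((x 1)\<^sup>2) ^ m1 / s ^ m1 * PS / PT"
    proof (intro divide_right_mono mult_right_mono)
      show "(det W)\<^sup>2 \<le> P * ((x 1)\<^sup>2) ^ m1 / s ^ m1"
        using W_le s x1 by (simp add: power_divide field_simps)
      show "0 \<le> PS" unfolding PS_def by (intro prod_nonneg) auto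
    qed (use PT in simp)
    also have "\<dots> = bound_rhs n k T x"
    proof -
      \<comment> \<open>The exponents may be negative; as \<open>x i\<close> is nonzero, each factor
        splits into a quotient of natural powers.\<close>
      have "(\<Prod>i\<in>{1..n}. (x i ^ 2) powi (int m1 - int (vdeg T i))) =
          (\<Prod>i\<in>{1..n}. ((x i)\<^sup>2) ^ m1 / ((x i)\<^sup>2) ^ vdeg T i)"
        using x by (intro prod.cong refl) (simp add: power_int_diff)
      also have "\<dots> = (\<Prod>i\<in>{1..n}. ((x i)\<^sup>2) ^ m1) / PT"
        by (simp add: prod_dividef PT_def)
      \<comment> \<open>The power of \<open>x 1\<close> left over from the Gram determinant supplies
        the vertex missing in \<open>PS\<close>.\<close>
      also have "(\<Prod>i\<in>{1..n}. ((x i)\<^sup>2) ^ m1) = ((x 1)\<^sup>2) ^ m1 * PS"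
        unfolding n1 PS_def by simp
      finally show ?thesis
        unfolding bound_rhs_def m1_def[symmetric] s_def[symmetric] P_def[symmetric] by (simp add: mult_ac)
    qed
    finally show ?thesis .
  qed
  \<comment> \<open>The constant weight 1 witnesses that the set is nonempty, without which
    \<open>Inf\<close> would carry no information.\<close>
  moreover have "real (homology_order n k T) ^ 2
      \<le> Inf {bound_rhs n k T x | x :: nat \<Rightarrow> real. \<forall>i\<in>{1..n}. x i \<noteq> 0}"
    by (rule cInf_greatest) (auto intro!: bound exI[of _ "\<lambda>_. 1"])
  ultimately show ?thesis by blast
qed

end
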